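(* The ai-semiring $S_{(4,124)}$ is nonfinitely based.
   Context: An additively idempotent semiring (ai-semiring) is an algebra $(S,+,\cdot)$ with two binary operations (no constants in the signature) such that $(S,+)$ is a commutative idempotent semigroup, $(S,\cdot)$ is a semigroup, and $x(y+z)\approx xy+xz$ and $(x+y)z\approx xz+yz$ hold. Let $X$ be a countably infinite set of variables. A term is a finite nonempty set of words of the free semigroup $X^+$, written as a formal sum of its elements; an identity is a formal expression $\mathbf{u}\approx\mathbf{v}$ with $\mathbf{u},\mathbf{v}$ terms; it holds in $S$ if both sides take the same value in $S$ under every assignment of elements of $S$ to the variables. A variety of ai-semirings is a class of ai-semirings closed under subalgebras, homomorphic images and arbitrary direct products (equivalently, the class of all ai-semirings satisfying some set of identities). A variety is finitely based if it can be defined, within ai-semirings, by a finite set of identities; otherwise it is nonfinitely based. An ai-semiring $S$ is nonfinitely based if the variety $\mathsf{V}(S)$ it generates is nonfinitely based. $S_{(4,124)}=\{1,2,3,4\}$ is the ai-semiring with Cayley tables $$\begin{array}{c|cccc} + & 1&2&3&4\\ \hline 1&1&1&1&1\\ 2&1&2&2&1\\ 3&1&2&3&1\\ 4&1&1&1&4\end{array}\qquad \begin{array}{c|cccc} \cdot & 1&2&3&4\\ \hline 1&1&1&1&1\\ 2&1&1&2&1\\ 3&1&2&3&4\\ 4&1&1&4&2\end{array}$$ *)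

theory Defs
  imports Main "HOL-Library.FuncSet"
begin

record 'a alg =
  carrier :: "'a set"
  add :: "'a \<Rightarrow> 'a \<Rightarrow> 'a"
  mul :: "'a \<Rightarrow> 'a \<Rightarrow> 'a"

text \<open>The carrier is nonempty, as usual for algebras. The operations are unconstrained outside
  the carrier.\<close>

definition ai_semiring :: "'a alg \<Rightarrow> bool" where
  "ai_semiring A \<longleftrightarrow>
     carrier A \<noteq> {} \<and>
     (\<forall>x\<in>carrier A. \<forall>y\<in>carrier A. add A x y \<in> carrier A \<and> mul A x y \<in> carrier A) \<and>
     (\<forall>x\<in>carrier A. add A x x = x) \<and>
     (\<forall>x\<in>carrier A. \<forall>y\<in>carrier A. add A x y = add A y x) \<and>
     (\<forall>x\<in>carrier A. \<forall>y\<in>carrier A. \<forall>z\<in>carrier A.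
        add A (add A x y) z = add A x (add A y z) \<and>
        mul A (mul A x y) z = mul A x (mul A y z) \<and>
        mul A x (add A y z) = add A (mul A x y) (mul A x z) \<and>
        mul A (add A x y) z = add A (mul A x z) (mul A y z))"

fun foldr1 :: "('a \<Rightarrow> 'a \<Rightarrow> 'a) \<Rightarrow> 'a list \<Rightarrow> 'a" where
  "foldr1 f [x] = x"
| "foldr1 f (x # y # zs) = f x (foldr1 f (y # zs))"
| "foldr1 f [] = undefined"

type_synonym 'v trm = "'v list set"

definition is_trm :: "'v trm \<Rightarrow> bool" where
  "is_trm u \<longleftrightarrow> finite u \<and> u \<noteq> {} \<and> [] \<notin> u"

definition eval_word :: "'a alg \<Rightarrow> ('v \<Rightarrow> 'a) \<Rightarrow> 'v list \<Rightarrow> 'a" where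
  "eval_word A \<phi> w = foldr1 (mul A) (map \<phi> w)"

text \<open>The sum over a term is taken along some enumeration of its words; in an ai-semiring the
  result does not depend on the enumeration, see \<open>eval_trm_set\<close> below.\<close>

definition eval_trm :: "'a alg \<Rightarrow> ('v \<Rightarrow> 'a) \<Rightarrow> 'v trm \<Rightarrow> 'a" where
  "eval_trm A \<phi> u = foldr1 (add A) (map (eval_word A \<phi>) (SOME ws. set ws = u))"

text \<open>Identities are over the countably infinite set of variables \<^typ>\<open>nat\<close>.\<close>

definition identities :: "(nat trm \<times> nat trm) set" where
  "identities = {(u, v). is_trm u \<and> is_trm v}"

definition satisfies :: "'a alg \<Rightarrow> nat trm \<times> nat trm \<Rightarrow> bool" where
  "satisfies A e \<longleftrightarrow>
     (\<forall>\<phi>. range \<phi> \<subseteq> carrier A \<longrightarrow> eval_trm A \<phi> (fst e) = eval_trm A \<phi> (snd e))"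

text \<open>Classes of ai-semirings are sets of ai-semirings whose elements come from a universe
  \<open>'a\<close>. Every infinite universe contains copies of all countable ai-semirings, and these
  determine which identities follow from a given set of identities. The algebra generating a
  variety may have its elements in another type.\<close>

definition models :: "(nat trm \<times> nat trm) set \<Rightarrow> 'a alg set" where
  "models \<Sigma> = {A. ai_semiring A \<and> (\<forall>e\<in>\<Sigma>. satisfies A e)}"

definition generated_variety :: "'s alg \<Rightarrow> 'a alg set" where
  "generated_variety S = models {e \<in> identities. satisfies S e}"

definition finitely_based :: "'a alg set \<Rightarrow> bool" where
  "finitely_based K \<longleftrightarrow> (\<exists>\<Sigma>. finite \<Sigma> \<and> \<Sigma> \<subseteq> identities \<and> K = models \<Sigma>)"

definition S_4_124 :: "nat alg" where
  "S_4_124 =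
    \<lparr> carrier = {1, 2, 3, 4},
      add = (\<lambda>i j. [[1, 1, 1, 1],
                    [1, 2, 2, 1],
                    [1, 2, 3, 1],
                    [1, 1, 1, 4]] ! (i - 1) ! (j - 1)),
      mul = (\<lambda>i j. [[1, 1, 1, 1],
                    [1, 1, 2, 1],
                    [1, 2, 3, 4],
                    [1, 1, 4, 2]] ! (i - 1) ! (j - 1)) \<rparr>"

lemma ai_semiring_S_4_124: "ai_semiring S_4_124"
  by (simp add: ai_semiring_def S_4_124_def)


subsection \<open>Evaluation in ai-semirings\<close>

lemma ai_semiringD:
  assumes "ai_semiring A"
  shows "carrier A \<noteq> {}"
    and "x \<in> carrier A \<Longrightarrow> y \<in> carrier A \<Longrightarrow> add A x y \<in> carrier A"
    and "x \<in> carrier A \<Longrightarrow> y \<in> carrier A \<Longrightarrow> mul A x y \<in> carrier A"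
    and "x \<in> carrier A \<Longrightarrow> add A x x = x"
    and "x \<in> carrier A \<Longrightarrow> y \<in> carrier A \<Longrightarrow> add A x y = add A y x"
    and "x \<in> carrier A \<Longrightarrow> y \<in> carrier A \<Longrightarrow> z \<in> carrier A \<Longrightarrow>
           add A (add A x y) z = add A x (add A y z)"
    and "x \<in> carrier A \<Longrightarrow> y \<in> carrier A \<Longrightarrow> z \<in> carrier A \<Longrightarrow>
           mul A (mul A x y) z = mul A x (mul A y z)"
    and "x \<in> carrier A \<Longrightarrow> y \<in> carrier A \<Longrightarrow> z \<in> carrier A \<Longrightarrow>
           mul A x (add A y z) = add A (mul A x y) (mul A x z)"
    and "x \<in> carrier A \<Longrightarrow> y \<in> carrier A \<Longrightarrow> z \<in> carrier A \<Longrightarrow>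
           mul A (add A x y) z = add A (mul A x z) (mul A y z)"
  using assms unfolding ai_semiring_def by blast+

lemma foldr1_closed:
  assumes "xs \<noteq> []" "set xs \<subseteq> C" "\<And>x y. x \<in> C \<Longrightarrow> y \<in> C \<Longrightarrow> f x y \<in> C"
  shows "foldr1 f xs \<in> C"
  using assms by (induction f xs rule: foldr1.induct) auto

lemma foldr1_add_le_iff:
  assumes A: "ai_semiring A" and "xs \<noteq> []" "set xs \<subseteq> carrier A" and z: "z \<in> carrier A"
  shows "add A (foldr1 (add A) xs) z = z \<longleftrightarrow> (\<forall>x\<in>set xs. add A x z = z)"
  using assms(2,3)
proof (induction "add A" xs rule: foldr1.induct)
  case (2 x y zs)
  let ?s = "foldr1 (add A) (y # zs)"
  note D = ai_semiringD[OF A]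
  have x: "x \<in> carrier A" using 2 by auto
  have s: "?s \<in> carrier A"
    using 2 by (intro foldr1_closed) (auto intro: D(2,3))
  have IH: "add A ?s z = z \<longleftrightarrow> (\<forall>x\<in>set (y # zs). add A x z = z)"
    using 2 by auto
  have "add A (add A x ?s) z = z \<longleftrightarrow> add A x z = z \<and> add A ?s z = z"
  proof
    assume h: "add A (add A x ?s) z = z"
    have "add A x z = add A x (add A (add A x ?s) z)" using h by simp
    also have "\<dots> = add A (add A x ?s) z" using x s z by (metis D(2,4,6))
    finally have 1: "add A x z = z" using h by simp
    have "add A ?s z = add A ?s (add A (add A ?s x) z)" using h D(5)[OF x s] by simp
    also have "\<dots> = add A (add A ?s x) z" using x s z by (metis D(2,4,6))
    finally have "add A ?s z = z" using h D(5)[OF x s] by simp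
    with 1 show "add A x z = z \<and> add A ?s z = z" by simp
  next
    assume "add A x z = z \<and> add A ?s z = z"
    then show "add A (add A x ?s) z = z" using D(6)[OF x s z] by simp
  qed
  then show ?case using IH by simp
qed auto

lemma foldr1_add_cong_set:
  assumes A: "ai_semiring A" and "xs \<noteq> []" "set xs \<subseteq> carrier A" "set xs = set ys"
  shows "foldr1 (add A) xs = foldr1 (add A) ys"
proof -
  note D = ai_semiringD[OF A]
  let ?a = "foldr1 (add A) xs" and ?b = "foldr1 (add A) ys"
  have ys: "ys \<noteq> []" "set ys \<subseteq> carrier A" using assms by auto
  have a: "?a \<in> carrier A" using assms by (intro foldr1_closed) (auto intro: D(2,3))
  have b: "?b \<in> carrier A" using ys by (intro foldr1_closed) (auto intro: D(2,3))
  have "add A ?a ?b = ?b"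
    using foldr1_add_le_iff[OF A assms(2,3) b] foldr1_add_le_iff[OF A ys b] D(4)[OF b] assms(4)
    by simp
  moreover have "add A ?b ?a = ?a"
    using foldr1_add_le_iff[OF A assms(2,3) a] foldr1_add_le_iff[OF A ys a] D(4)[OF a] assms(4)
    by simp
  ultimately show ?thesis using D(5)[OF a b] by simp
qed

lemma eval_word_closed:
  assumes A: "ai_semiring A" and "w \<noteq> []" "\<phi> ` set w \<subseteq> carrier A"
  shows "eval_word A \<phi> w \<in> carrier A"
  unfolding eval_word_def using assms by (intro foldr1_closed) (auto intro: ai_semiringD(2,3)[OF A])

lemma eval_trm_set:
  assumes A: "ai_semiring A" and "ws \<noteq> []" "[] \<notin> set ws"
    and "\<And>w. w \<in> set ws \<Longrightarrow> \<phi> ` set w \<subseteq> carrier A"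
  shows "eval_trm A \<phi> (set ws) = foldr1 (add A) (map (eval_word A \<phi>) ws)"
proof -
  define ws' where "ws' = (SOME us. set us = set ws)"
  have ws': "set ws' = set ws"
    unfolding ws'_def by (rule someI[of "\<lambda>us. set us = set ws" ws]) simp
  have "foldr1 (add A) (map (eval_word A \<phi>) ws) = foldr1 (add A) (map (eval_word A \<phi>) ws')"
    using assms ws' by (intro foldr1_add_cong_set) (auto intro!: eval_word_closed)
  then show ?thesis by (simp add: eval_trm_def ws'_def)
qed

lemma trm_enum:
  assumes "is_trm u"
  obtains ws where "ws \<noteq> []" "[] \<notin> set ws" "u = set ws"
  using assms unfolding is_trm_def by (metis finite_list set_empty)

lemma eval_trm_closed:
  assumes A: "ai_semiring A" and u: "is_trm u"
    and "\<And>w. w \<in> u \<Longrightarrow> \<phi> ` set w \<subseteq> carrier A"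
  shows "eval_trm A \<phi> u \<in> carrier A"
proof -
  from u obtain ws where ws: "ws \<noteq> []" "[] \<notin> set ws" "u = set ws" by (rule trm_enum)
  have "eval_word A \<phi> w \<in> carrier A" if "w \<in> set ws" for w
    using ws assms(3) that by (metis eval_word_closed[OF A])
  then have "foldr1 (add A) (map (eval_word A \<phi>) ws) \<in> carrier A"
    using ws(1) by (intro foldr1_closed) (auto intro: ai_semiringD(2,3)[OF A])
  then show ?thesis using eval_trm_set[OF A ws(1,2)] ws assms(3) by simp
qed

lemma foldr1_hom:
  assumes "xs \<noteq> []" "set xs \<subseteq> C" "\<And>x y. x \<in> C \<Longrightarrow> y \<in> C \<Longrightarrow> f x y \<in> C"
    and "\<And>x y. x \<in> C \<Longrightarrow> y \<in> C \<Longrightarrow> h (f x y) = g (h x) (h y)"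
  shows "h (foldr1 f xs) = foldr1 g (map h xs)"
  using assms
proof (induction f xs rule: foldr1.induct)
  case (2 f x y zs)
  have "foldr1 f (y # zs) \<in> C" using 2 by (intro foldr1_closed) auto
  then show ?case using 2 by simp
qed auto


subsection \<open>The generated variety is the closure under homomorphic images, subalgebras, products\<close>

definition is_hom :: "'a alg \<Rightarrow> 'b alg \<Rightarrow> ('a \<Rightarrow> 'b) \<Rightarrow> bool" where
  "is_hom A B h \<longleftrightarrow> h ` carrier A \<subseteq> carrier B \<and>
     (\<forall>x\<in>carrier A. \<forall>y\<in>carrier A.
        h (add A x y) = add B (h x) (h y) \<and> h (mul A x y) = mul B (h x) (h y))"

definition subalgebra :: "'a alg \<Rightarrow> 'a alg \<Rightarrow> bool" where
  "subalgebra B A \<longleftrightarrow> carrier B \<subseteq> carrier A \<and> carrier B \<noteq> {} \<and> add B = add A \<and> mul B = mul A \<and>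
     (\<forall>x\<in>carrier B. \<forall>y\<in>carrier B. add A x y \<in> carrier B \<and> mul A x y \<in> carrier B)"

definition product_alg :: "'i set \<Rightarrow> ('i \<Rightarrow> 'a alg) \<Rightarrow> ('i \<Rightarrow> 'a) alg" where
  "product_alg I F =
    \<lparr> carrier = (\<Pi>\<^sub>E i\<in>I. carrier (F i)),
      add = (\<lambda>x y. \<lambda>i\<in>I. add (F i) (x i) (y i)),
      mul = (\<lambda>x y. \<lambda>i\<in>I. mul (F i) (x i) (y i)) \<rparr>"

lemma hom_eval_word:
  assumes A: "ai_semiring A" and h: "is_hom A B h" and "w \<noteq> []" "\<phi> ` set w \<subseteq> carrier A"
  shows "h (eval_word A \<phi> w) = eval_word B (h \<circ> \<phi>) w"
proof -
  have "h (foldr1 (mul A) (map \<phi> w)) = foldr1 (mul B) (map h (map \<phi> w))"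
    using assms
    by (intro foldr1_hom[where C = "carrier A"]) (auto simp: is_hom_def intro: ai_semiringD(2,3)[OF A])
  then show ?thesis by (simp add: eval_word_def)
qed

lemma hom_eval_trm:
  assumes A: "ai_semiring A" and B: "ai_semiring B" and h: "is_hom A B h" and u: "is_trm u"
    and \<phi>: "\<And>w. w \<in> u \<Longrightarrow> \<phi> ` set w \<subseteq> carrier A"
  shows "h (eval_trm A \<phi> u) = eval_trm B (h \<circ> \<phi>) u"
proof -
  from u obtain ws where ws: "ws \<noteq> []" "[] \<notin> set ws" "u = set ws" by (rule trm_enum)
  have h\<phi>: "(h \<circ> \<phi>) ` set w \<subseteq> carrier B" if "w \<in> u" for w
    using \<phi>[OF that] h by (auto simp: is_hom_def)
  have c: "eval_word A \<phi> w \<in> carrier A" if "w \<in> set ws" for w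
    using ws \<phi> that by (metis eval_word_closed[OF A])
  have "h (eval_trm A \<phi> u) = h (foldr1 (add A) (map (eval_word A \<phi>) ws))"
    using eval_trm_set[OF A ws(1,2)] ws \<phi> by simp
  also have "\<dots> = foldr1 (add B) (map h (map (eval_word A \<phi>) ws))"
    using ws h c
    by (intro foldr1_hom[where C = "carrier A"]) (auto simp: is_hom_def intro: ai_semiringD(2,3)[OF A])
  also have "map h (map (eval_word A \<phi>) ws) = map (eval_word B (h \<circ> \<phi>)) ws"
  proof -
    have "h (eval_word A \<phi> w) = eval_word B (h \<circ> \<phi>) w" if "w \<in> set ws" for w
      using ws \<phi> that by (intro hom_eval_word[OF A h]) auto
    then show ?thesis by simp
  qed
  also have "foldr1 (add B) \<dots> = eval_trm B (h \<circ> \<phi>) u"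
    using eval_trm_set[OF B ws(1,2)] ws h\<phi> by simp
  finally show ?thesis .
qed

lemma hom_image_ai_semiring:
  assumes A: "ai_semiring A" and h: "is_hom A B h" and s: "h ` carrier A = carrier B"
  shows "ai_semiring B"
proof -
  note D = ai_semiringD[OF A]
  have H: "add B (h x) (h y) = h (add A x y)" "mul B (h x) (h y) = h (mul A x y)"
    if "x \<in> carrier A" "y \<in> carrier A" for x y
    using h that by (auto simp: is_hom_def)
  show ?thesis
    unfolding ai_semiring_def s[symmetric] using D(1)
    by (simp add: H D(2-4) D(6-9)) (metis D(5))
qed

lemma subalgebra_ai_semiring:
  assumes A: "ai_semiring A" and B: "subalgebra B A"
  shows "ai_semiring B"
proof -
  note D = ai_semiringD[OF A]
  have c: "x \<in> carrier A" if "x \<in> carrier B" for x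
    using B that by (auto simp: subalgebra_def)
  have B': "carrier B \<noteq> {}" "add B = add A" "mul B = mul A"
    and cl: "x \<in> carrier B \<Longrightarrow> y \<in> carrier B \<Longrightarrow> add A x y \<in> carrier B"
      "x \<in> carrier B \<Longrightarrow> y \<in> carrier B \<Longrightarrow> mul A x y \<in> carrier B" for x y
    using B by (auto simp: subalgebra_def)
  show ?thesis
    unfolding ai_semiring_def B'
    by (intro conjI ballI B'(1) cl D(4-9) c; assumption)
qed

lemma product_ai_semiring:
  assumes "\<And>i. i \<in> I \<Longrightarrow> ai_semiring (F i)"
  shows "ai_semiring (product_alg I F)"
proof -
  note D = ai_semiringD[OF assms]
  have n: "(\<Pi>\<^sub>E i\<in>I. carrier (F i)) \<noteq> {}"
    using D(1) by (simp add: PiE_eq_empty_iff)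
  have comm: "add (F i) (x i) (y i) = add (F i) (y i) (x i)"
    if "x \<in> (\<Pi>\<^sub>E i\<in>I. carrier (F i))" "y \<in> (\<Pi>\<^sub>E i\<in>I. carrier (F i))" "i \<in> I" for x y i
    using that by (intro D(5)) auto
  show ?thesis
    unfolding ai_semiring_def product_alg_def alg.simps
    by (intro conjI ballI n)
      (auto simp: PiE_iff fun_eq_iff extensional_def D(2-4) D(6-9) comm[unfolded PiE_iff extensional_def])
qed

lemma hom_image_in_models:
  assumes \<Sigma>: "\<Sigma> \<subseteq> identities" and A: "A \<in> models \<Sigma>"
    and h: "is_hom A B h" and s: "h ` carrier A = carrier B"
  shows "B \<in> models \<Sigma>"
proof -
  have aiA: "ai_semiring A" using A by (simp add: models_def)
  have aiB: "ai_semiring B" using hom_image_ai_semiring[OF aiA h s] .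
  have "satisfies B e" if e: "e \<in> \<Sigma>" for e
    unfolding satisfies_def
  proof (intro allI impI)
    fix \<phi> :: "nat \<Rightarrow> 'b" assume "range \<phi> \<subseteq> carrier B"
    then have "\<phi> n \<in> h ` carrier A" for n using s by auto
    then have "\<forall>n. \<exists>x. x \<in> carrier A \<and> h x = \<phi> n" by (auto simp: image_iff) metis
    then obtain \<psi> where \<psi>: "\<And>n. \<psi> n \<in> carrier A" "\<And>n. h (\<psi> n) = \<phi> n" by metis
    have c: "h \<circ> \<psi> = \<phi>" using \<psi> by auto
    have t: "is_trm (fst e)" "is_trm (snd e)" using \<Sigma> e by (auto simp: identities_def)
    have "eval_trm A \<psi> (fst e) = eval_trm A \<psi> (snd e)"
      using A e image_subsetI[of UNIV \<psi> "carrier A"] \<psi>(1) by (simp add: models_def satisfies_def)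
    then have "h (eval_trm A \<psi> (fst e)) = h (eval_trm A \<psi> (snd e))" by simp
    then show "eval_trm B \<phi> (fst e) = eval_trm B \<phi> (snd e)"
      using hom_eval_trm[OF aiA aiB h t(1), of \<psi>] hom_eval_trm[OF aiA aiB h t(2), of \<psi>] \<psi> c
      by (simp add: image_subset_iff)
  qed
  with aiB show ?thesis by (simp add: models_def)
qed

lemma subalgebra_in_models:
  assumes "A \<in> models \<Sigma>" and B: "subalgebra B A"
  shows "B \<in> models \<Sigma>"
proof -
  have "eval_word B = (eval_word A :: (nat \<Rightarrow> _) \<Rightarrow> _)"
    using B by (intro ext) (simp add: eval_word_def subalgebra_def)
  then have "eval_trm B = (eval_trm A :: (nat \<Rightarrow> _) \<Rightarrow> _)"
    using B by (intro ext) (simp add: eval_trm_def subalgebra_def)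
  moreover have "carrier B \<subseteq> carrier A" using B by (simp add: subalgebra_def)
  ultimately show ?thesis
    using assms subalgebra_ai_semiring[OF _ B] by (simp add: models_def satisfies_def)
qed

lemma product_proj_hom:
  "i \<in> I \<Longrightarrow> is_hom (product_alg I F) (F i) (\<lambda>x. x i)"
  by (auto simp: is_hom_def product_alg_def)

lemma product_in_models:
  fixes F :: "'i \<Rightarrow> 'a alg"
  assumes \<Sigma>: "\<Sigma> \<subseteq> identities" and F: "\<And>i. i \<in> I \<Longrightarrow> F i \<in> models \<Sigma>"
  shows "product_alg I F \<in> models \<Sigma>"
proof -
  have ai: "ai_semiring (F i)" if "i \<in> I" for i using F[OF that] by (simp add: models_def)
  have aiP: "ai_semiring (product_alg I F)" using product_ai_semiring ai by blast
  have "satisfies (product_alg I F) e" if e: "e \<in> \<Sigma>" for e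
    unfolding satisfies_def
  proof (intro allI impI)
    let ?P = "product_alg I F"
    fix \<phi> :: "nat \<Rightarrow> 'i \<Rightarrow> 'a" assume \<phi>: "range \<phi> \<subseteq> carrier ?P"
    have t: "is_trm (fst e)" "is_trm (snd e)" using \<Sigma> e by (auto simp: identities_def)
    have P: "eval_trm ?P \<phi> (fst e) \<in> carrier ?P" "eval_trm ?P \<phi> (snd e) \<in> carrier ?P"
      using t \<phi> by (auto intro!: eval_trm_closed[OF aiP])
    have "eval_trm ?P \<phi> (fst e) i = eval_trm ?P \<phi> (snd e) i" if i: "i \<in> I" for i
    proof -
      have "range ((\<lambda>x. x i) \<circ> \<phi>) \<subseteq> carrier (F i)"
        using \<phi> i by (auto simp: product_alg_def)
      then have "eval_trm (F i) ((\<lambda>x. x i) \<circ> \<phi>) (fst e) = eval_trm (F i) ((\<lambda>x. x i) \<circ> \<phi>) (snd e)"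
        using F[OF i] e unfolding models_def satisfies_def by blast
      moreover have "eval_trm ?P \<phi> u i = eval_trm (F i) ((\<lambda>x. x i) \<circ> \<phi>) u" if "is_trm u" for u
        using hom_eval_trm[OF aiP ai[OF i] product_proj_hom[OF i] that, of \<phi>] \<phi> by blast
      ultimately show ?thesis using t by simp
    qed
    then show "eval_trm ?P \<phi> (fst e) = eval_trm ?P \<phi> (snd e)"
      using P by (auto simp: product_alg_def intro: PiE_ext)
  qed
  with aiP show ?thesis by (simp add: models_def)
qed

lemma generator_in_generated_variety: "ai_semiring S \<Longrightarrow> S \<in> generated_variety S"
  by (simp add: generated_variety_def models_def)

lemma eval_trm_union:
  assumes A: "ai_semiring A" and t: "is_trm t" and u: "is_trm u"
    and \<phi>: "\<And>w. w \<in> t \<union> u \<Longrightarrow> \<phi> ` set w \<subseteq> carrier A"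
  shows "eval_trm A \<phi> (t \<union> u) = add A (eval_trm A \<phi> t) (eval_trm A \<phi> u)"
proof -
  note D = ai_semiringD[OF A]
  obtain ts us where ts: "ts \<noteq> []" "[] \<notin> set ts" "t = set ts"
    and us: "us \<noteq> []" "[] \<notin> set us" "u = set us"
    using t u by (metis trm_enum)
  have app: "foldr1 (add A) (xs @ ys) = add A (foldr1 (add A) xs) (foldr1 (add A) ys)"
    if "xs \<noteq> []" "ys \<noteq> []" "set xs \<subseteq> carrier A" "set ys \<subseteq> carrier A" for xs ys
    using that
  proof (induction "add A" xs rule: foldr1.induct)
    case (1 x)
    then show ?case by (cases ys) auto
  next
    case (2 x y zs)
    have "foldr1 (add A) (y # zs) \<in> carrier A" "foldr1 (add A) ys \<in> carrier A"
      using 2 by (auto intro!: foldr1_closed intro: D(2,3))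
    then show ?case using 2 D(6) by simp
  qed auto
  have c: "set (map (eval_word A \<phi>) ts) \<subseteq> carrier A" "set (map (eval_word A \<phi>) us) \<subseteq> carrier A"
    using ts us \<phi> by (auto, (metis UnCI eval_word_closed[OF A])+)
  have "eval_trm A \<phi> (set (ts @ us)) = foldr1 (add A) (map (eval_word A \<phi>) (ts @ us))"
    using ts us \<phi> by (intro eval_trm_set[OF A]) auto
  then show ?thesis
    using eval_trm_set[OF A ts(1,2), of \<phi>] eval_trm_set[OF A us(1,2), of \<phi>] ts us \<phi> app c by simp
qed

lemma eval_trm_single [simp]: "eval_trm A \<phi> {w} = eval_word A \<phi> w" if "ai_semiring A" "w \<noteq> []"
  "\<phi> ` set w \<subseteq> carrier A"
  using eval_trm_set[OF that(1), of "[w]" \<phi>] that by simp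

lemma eval_word_append:
  assumes A: "ai_semiring A" and "v \<noteq> []" "w \<noteq> []"
    and "\<phi> ` set v \<subseteq> carrier A" "\<phi> ` set w \<subseteq> carrier A"
  shows "eval_word A \<phi> (v @ w) = mul A (eval_word A \<phi> v) (eval_word A \<phi> w)"
  using assms(2-)
proof (induction v rule: list_nonempty_induct)
  case (single x)
  then show ?case by (cases w) (auto simp: eval_word_def)
next
  case (cons x xs)
  have c: "eval_word A \<phi> (x # ys) = mul A (\<phi> x) (eval_word A \<phi> ys)" if "ys \<noteq> []" for ys
    using that by (cases ys) (auto simp: eval_word_def)
  have "eval_word A \<phi> xs \<in> carrier A" "eval_word A \<phi> w \<in> carrier A"
    using cons by (auto intro!: eval_word_closed[OF A])
  then show ?case using cons ai_semiringD(7)[OF A] by (simp add: c)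
qed

definition trm_mul :: "'v trm \<Rightarrow> 'v trm \<Rightarrow> 'v trm" where
  "trm_mul t u = {v @ w | v w. v \<in> t \<and> w \<in> u}"

lemma is_trm_mul: "is_trm t \<Longrightarrow> is_trm u \<Longrightarrow> is_trm (trm_mul t u)"
proof -
  have "trm_mul t u = (\<lambda>(v, w). v @ w) ` (t \<times> u)" by (auto simp: trm_mul_def)
  then show "is_trm t \<Longrightarrow> is_trm u \<Longrightarrow> is_trm (trm_mul t u)" by (auto simp: is_trm_def)
qed

lemma is_trm_un: "is_trm t \<Longrightarrow> is_trm u \<Longrightarrow> is_trm (t \<union> u)"
  by (auto simp: is_trm_def)

lemma trm_induct [consumes 1, case_names single union]:
  assumes "is_trm t" and "\<And>w. w \<noteq> [] \<Longrightarrow> P {w}"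
    and "\<And>w t. w \<noteq> [] \<Longrightarrow> is_trm t \<Longrightarrow> P t \<Longrightarrow> P ({w} \<union> t)"
  shows "P t"
proof -
  have "finite t" "t \<noteq> {}" "[] \<notin> t" using assms(1) by (auto simp: is_trm_def)
  then show ?thesis
  proof (induction t rule: finite_ne_induct)
    case (insert w F)
    then show ?case using assms(3)[of w F] by (auto simp: is_trm_def)
  qed (use assms(2) in auto)
qed

lemma eval_trm_mul:
  assumes A: "ai_semiring A" and t: "is_trm t" and u: "is_trm u"
    and \<phi>: "\<And>w. w \<in> t \<union> u \<Longrightarrow> \<phi> ` set w \<subseteq> carrier A"
  shows "eval_trm A \<phi> (trm_mul t u) = mul A (eval_trm A \<phi> t) (eval_trm A \<phi> u)"
proof -
  note D = ai_semiringD[OF A]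
  have tm: "is_trm {w}" if "w \<noteq> []" for w :: "'b list" using that by (simp add: is_trm_def)
  have one: "eval_trm A \<phi> (trm_mul {v} u) = mul A (eval_word A \<phi> v) (eval_trm A \<phi> u)"
    if v: "v \<noteq> []" "\<phi> ` set v \<subseteq> carrier A"
      and "is_trm u" "\<And>w. w \<in> u \<Longrightarrow> \<phi> ` set w \<subseteq> carrier A" for v u
    using that(3-)
  proof (induction rule: trm_induct)
    case (single w)
    have "trm_mul {v} {w} = {v @ w}" by (auto simp: trm_mul_def)
    then show ?case using single v A by (simp add: eval_word_append image_Un)
  next
    case (union w u)
    have w: "\<phi> ` set w \<subseteq> carrier A" and u': "\<And>x. x \<in> u \<Longrightarrow> \<phi> ` set x \<subseteq> carrier A"
      using union.prems by auto
    have c: "eval_word A \<phi> v \<in> carrier A" "eval_word A \<phi> w \<in> carrier A" "eval_trm A \<phi> u \<in> carrier A"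
      using v w u' union.hyps by (intro eval_word_closed[OF A] eval_trm_closed[OF A]; blast)+
    have "trm_mul {v} ({w} \<union> u) = {v @ w} \<union> trm_mul {v} u" by (auto simp: trm_mul_def)
    moreover have "eval_trm A \<phi> ({v @ w} \<union> trm_mul {v} u)
        = add A (eval_trm A \<phi> {v @ w}) (eval_trm A \<phi> (trm_mul {v} u))"
    proof (rule eval_trm_union[OF A])
      show "is_trm {v @ w}" using v by (simp add: is_trm_def)
      show "is_trm (trm_mul {v} u)" using v union by (intro is_trm_mul tm)
      show "\<phi> ` set x \<subseteq> carrier A" if "x \<in> {v @ w} \<union> trm_mul {v} u" for x
      proof -
        from that obtain y where "x = v @ y" "y \<in> {w} \<union> u" by (auto simp: trm_mul_def)
        then show ?thesis using v(2) union.prems[of y] by (simp add: image_Un)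
      qed
    qed
    moreover have "eval_trm A \<phi> ({w} \<union> u) = add A (eval_trm A \<phi> {w}) (eval_trm A \<phi> u)"
      using union.hyps w u' by (intro eval_trm_union[OF A] tm) blast+
    ultimately show ?case
      using union.IH[OF u'] union.hyps v w c A by (simp add: eval_word_append image_Un D(8))
  qed
  show ?thesis
    using t \<phi>
  proof (induction rule: trm_induct)
    case (single v)
    then show ?case using one[OF _ _ u] A by simp
  next
    case (union v t)
    have v: "\<phi> ` set v \<subseteq> carrier A" and t': "\<And>x. x \<in> t \<union> u \<Longrightarrow> \<phi> ` set x \<subseteq> carrier A"
      using union.prems by auto
    have c: "eval_word A \<phi> v \<in> carrier A" "eval_trm A \<phi> t \<in> carrier A" "eval_trm A \<phi> u \<in> carrier A"
      using v t' u union.hyps by (intro eval_word_closed[OF A] eval_trm_closed[OF A]; blast)+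
    have "trm_mul ({v} \<union> t) u = trm_mul {v} u \<union> trm_mul t u" by (auto simp: trm_mul_def)
    moreover have "eval_trm A \<phi> (trm_mul {v} u \<union> trm_mul t u)
        = add A (eval_trm A \<phi> (trm_mul {v} u)) (eval_trm A \<phi> (trm_mul t u))"
    proof (rule eval_trm_union[OF A])
      show "is_trm (trm_mul {v} u)" "is_trm (trm_mul t u)"
        using union u by (auto intro!: is_trm_mul tm)
      show "\<phi> ` set x \<subseteq> carrier A" if "x \<in> trm_mul {v} u \<union> trm_mul t u" for x
      proof -
        from that obtain y z where "x = y @ z" "y \<in> {v} \<union> t" "z \<in> u" by (auto simp: trm_mul_def)
        then show ?thesis using union.prems[of y] union.prems[of z] by (auto simp: image_Un)
      qed
    qed
    moreover have "eval_trm A \<phi> ({v} \<union> t) = add A (eval_trm A \<phi> {v}) (eval_trm A \<phi> t)"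
      using union.hyps v t' by (intro eval_trm_union[OF A] tm) blast+
    ultimately show ?case
      using union.IH[OF t'] union.hyps v t' c A one[OF _ v u] by (simp add: D(9))
  qed
qed

lemma eval_trm_rename:
  assumes A: "ai_semiring A" and t: "is_trm t" and \<phi>: "range \<phi> \<subseteq> carrier A"
  shows "eval_trm A \<phi> (map r ` t) = eval_trm A (\<phi> \<circ> r) t"
proof -
  from t obtain ws where ws: "ws \<noteq> []" "[] \<notin> set ws" "t = set ws" by (rule trm_enum)
  have "eval_trm A \<phi> (set (map (map r) ws)) = foldr1 (add A) (map (eval_word A \<phi>) (map (map r) ws))"
    using ws \<phi> by (intro eval_trm_set[OF A]) auto
  also have "\<dots> = foldr1 (add A) (map (eval_word A (\<phi> \<circ> r)) ws)"
    by (simp add: eval_word_def[abs_def] comp_def)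
  also have "\<dots> = eval_trm A (\<phi> \<circ> r) (set ws)"
    using ws \<phi> by (intro eval_trm_set[OF A, symmetric]) auto
  finally show ?thesis using ws by simp
qed

lemma eval_trm_cong:
  assumes A: "ai_semiring A" and t: "is_trm t" and "\<And>w. w \<in> t \<Longrightarrow> \<phi> ` set w \<subseteq> carrier A"
    and e: "\<And>w x. w \<in> t \<Longrightarrow> x \<in> set w \<Longrightarrow> \<phi> x = \<psi> x"
  shows "eval_trm A \<phi> t = eval_trm A \<psi> t"
proof -
  from t obtain ws where ws: "ws \<noteq> []" "[] \<notin> set ws" "t = set ws" by (rule trm_enum)
  have "map (eval_word A \<phi>) ws = map (eval_word A \<psi>) ws"
    using e ws by (auto simp: eval_word_def cong: map_cong)
  moreover have "\<psi> ` set w \<subseteq> carrier A" if "w \<in> t" for w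
    using assms(3)[OF that] e[OF that] by (auto simp: image_subset_iff)
  ultimately show ?thesis
    using eval_trm_set[OF A ws(1,2), of \<phi>] eval_trm_set[OF A ws(1,2), of \<psi>] ws assms(3)
    by (simp del: map_eq_conv)
qed

text \<open>Conversely, every member of \<open>generated_variety S\<close> is a homomorphic image of a subalgebra of
  a direct power of \<open>S\<close>. Together with the closure lemmas above, \<open>generated_variety S\<close> is the
  least class containing \<open>S\<close> and closed under the three operations.\<close>

theorem generated_variety_HSP:
  fixes S :: "'s alg" and A :: "'a alg"
  assumes S: "ai_semiring S" and AV: "A \<in> generated_variety S"
  shows "\<exists>(I :: ('a \<Rightarrow> 's) set) B h.
    subalgebra B (product_alg I (\<lambda>_. S)) \<and> is_hom B A h \<and> h ` carrier B = carrier A"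
proof -
  have A: "ai_semiring A" using AV by (simp add: generated_variety_def models_def)
  define I :: "('a \<Rightarrow> 's) set" where "I = {\<phi>. range \<phi> \<subseteq> carrier S}"
  let ?P = "product_alg I (\<lambda>_. S)"
  define T where "T = {t :: 'a trm. is_trm t \<and> (\<forall>w\<in>t. set w \<subseteq> carrier A)}"
  define E where "E t = (\<lambda>\<phi>\<in>I. eval_trm S \<phi> t)" for t :: "'a trm"
  define B where "B = \<lparr>carrier = E ` T, add = add ?P, mul = mul ?P\<rparr>"
  define h where "h b = eval_trm A id (SOME t. t \<in> T \<and> b = E t)" for b
  have wd: "eval_trm A id t = eval_trm A id u" if t: "t \<in> T" and u: "u \<in> T" and eq: "E t = E u" for t u
  proof -
    define V where "V = (\<Union>w\<in>t \<union> u. set w)"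
    have it: "is_trm t" "is_trm u" using t u by (auto simp: T_def)
    have V: "finite V" "V \<subseteq> carrier A" using t u by (auto simp: V_def T_def is_trm_def)
    obtain r :: "'a \<Rightarrow> nat" where r: "inj_on r V"
      using finite_imp_inj_to_nat_seg[OF V(1)] by blast
    obtain a0 where a0: "a0 \<in> carrier A" using ai_semiringD(1)[OF A] by blast
    define \<psi> where "\<psi> n = (if n \<in> r ` V then inv_into V r n else a0)" for n
    have \<psi>: "range \<psi> \<subseteq> carrier A"
      using a0 V(2) inv_into_into[of _ r V] by (auto simp: \<psi>_def)
    have \<psi>r: "(\<psi> \<circ> r) x = x" if "x \<in> V" for x
      using that r by (simp add: \<psi>_def)
    have "satisfies S (map r ` t, map r ` u)"
      unfolding satisfies_def
    proof (intro allI impI, simp)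
      fix \<phi> :: "nat \<Rightarrow> 's" assume \<phi>: "range \<phi> \<subseteq> carrier S"
      then have "\<phi> \<circ> r \<in> I" by (auto simp: I_def)
      then have "eval_trm S (\<phi> \<circ> r) t = eval_trm S (\<phi> \<circ> r) u"
        using fun_cong[OF eq, of "\<phi> \<circ> r"] by (simp add: E_def)
      then show "eval_trm S \<phi> (map r ` t) = eval_trm S \<phi> (map r ` u)"
        using it \<phi> by (simp add: eval_trm_rename[OF S])
    qed
    moreover have "(map r ` t, map r ` u) \<in> identities"
      using it by (auto simp: identities_def is_trm_def)
    ultimately have "satisfies A (map r ` t, map r ` u)"
      using AV by (simp add: generated_variety_def models_def)
    then have "eval_trm A \<psi> (map r ` t) = eval_trm A \<psi> (map r ` u)"
      using \<psi> by (simp add: satisfies_def)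
    then have "eval_trm A (\<psi> \<circ> r) t = eval_trm A (\<psi> \<circ> r) u"
      using it \<psi> by (simp add: eval_trm_rename[OF A])
    moreover have "eval_trm A (\<psi> \<circ> r) t = eval_trm A id t"
      using it \<psi> \<psi>r by (intro eval_trm_cong[OF A]) (auto simp: V_def)
    moreover have "eval_trm A (\<psi> \<circ> r) u = eval_trm A id u"
      using it \<psi> \<psi>r by (intro eval_trm_cong[OF A]) (auto simp: V_def)
    ultimately show ?thesis by simp
  qed
  have hE: "h (E t) = eval_trm A id t" if "t \<in> T" for t
  proof -
    have "(SOME u. u \<in> T \<and> E t = E u) \<in> T \<and> E t = E (SOME u. u \<in> T \<and> E t = E u)"
      by (rule someI[of "\<lambda>u. u \<in> T \<and> E t = E u" t]) (use that in simp)
    then show ?thesis unfolding h_def using wd that by metis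
  qed
  have U: "t \<union> u \<in> T" "trm_mul t u \<in> T" if "t \<in> T" "u \<in> T" for t u
    using that is_trm_mul[of t u] is_trm_un[of t u] by (fastforce simp: T_def trm_mul_def)+
  have EU: "add ?P (E t) (E u) = E (t \<union> u)" "mul ?P (E t) (E u) = E (trm_mul t u)"
    if "t \<in> T" "u \<in> T" for t u
  proof -
    have tu: "is_trm t" "is_trm u" using that by (auto simp: T_def)
    have "eval_trm S \<phi> (t \<union> u) = add S (eval_trm S \<phi> t) (eval_trm S \<phi> u)"
      "eval_trm S \<phi> (trm_mul t u) = mul S (eval_trm S \<phi> t) (eval_trm S \<phi> u)"
      if "\<phi> \<in> I" for \<phi>
      using that by (intro eval_trm_union[OF S tu] eval_trm_mul[OF S tu]; force simp: I_def)+
    then show "add ?P (E t) (E u) = E (t \<union> u)" "mul ?P (E t) (E u) = E (trm_mul t u)"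
      by (auto simp: E_def product_alg_def intro!: restrict_ext)
  qed
  have single: "{[a]} \<in> T" "h (E {[a]}) = a" if "a \<in> carrier A" for a
  proof -
    show T: "{[a]} \<in> T" using that by (simp add: T_def is_trm_def)
    show "h (E {[a]}) = a" using hE[OF T] that A by (simp add: eval_word_def)
  qed
  have "subalgebra B ?P"
    unfolding subalgebra_def
  proof (intro conjI)
    have "eval_trm S \<phi> t \<in> carrier S" if "t \<in> T" "\<phi> \<in> I" for t \<phi>
      using that by (intro eval_trm_closed[OF S]) (auto simp: T_def I_def)
    then show "carrier B \<subseteq> carrier ?P"
      by (auto simp: B_def E_def product_alg_def)
    show "carrier B \<noteq> {}" using ai_semiringD(1)[OF A] single(1) by (auto simp: B_def)
    show "\<forall>x\<in>carrier B. \<forall>y\<in>carrier B. add ?P x y \<in> carrier B \<and> mul ?P x y \<in> carrier B"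
      using U by (auto simp: B_def EU)
  qed (auto simp: B_def)
  moreover have "is_hom B A h"
  proof -
    have "eval_trm A id t \<in> carrier A" if "t \<in> T" for t
      using that by (intro eval_trm_closed[OF A]) (simp_all add: T_def)
    moreover have "eval_trm A id (t \<union> u) = add A (eval_trm A id t) (eval_trm A id u)"
      "eval_trm A id (trm_mul t u) = mul A (eval_trm A id t) (eval_trm A id u)"
      if "t \<in> T" "u \<in> T" for t u
      using that by (intro eval_trm_union[OF A] eval_trm_mul[OF A]; auto 0 3 simp: T_def subset_iff)+
    ultimately show ?thesis
      by (auto simp: is_hom_def B_def EU hE U)
  qed
  moreover have "h ` carrier B = carrier A"
  proof
    show "h ` carrier B \<subseteq> carrier A" using \<open>is_hom B A h\<close> by (simp add: is_hom_def)
    show "carrier A \<subseteq> h ` carrier B"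
      using single by (auto simp: B_def image_iff) metis
  qed
  ultimately show ?thesis by blast
qed

end

theory Submission
  imports Defs "HOL-Library.Countable_Set" "HOL-Library.Multiset"
begin

text \<open>
  The multiplication of \<^term>\<open>S_4_124\<close> is that of the powers of \<open>a = 4\<close> (\<open>3\<close> is the unit, \<open>a\<^sup>2 = 2\<close>,
  \<open>a\<^sup>3 = 1\<close> is a zero), so an identity \<open>u \<approx> v\<close> holds iff under every assignment of natural weights
  to the letters the words of \<open>u\<close> have all their weights in \<open>Q\<close> exactly when those of \<open>v\<close> do, for
  \<open>Q\<close> one of \<open>{0}\<close>, \<open>{1}\<close>, \<open>{0, 2}\<close>. For odd \<open>N\<close>, the sum \<open>c\<close> of the words \<open>p x\<^sub>i x\<^sub>i\<^sub>+\<^sub>1\<close>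
  (\<open>i\<close> modulo \<open>N\<close>) satisfies \<open>c \<approx> c + p\<close>: weight \<open>1\<close> for \<open>p\<close> is harmful only if
  \<open>x\<^sub>i\<close> and \<open>x\<^sub>i\<^sub>+\<^sub>1\<close> always add up to \<open>1\<close>, which is impossible around an odd cycle, although it is
  possible as soon as one edge is missing. An identity with fewer than \<open>N\<close> words on each side
  sees only a proper part of the cycle. Hence it cannot turn \<open>c\<close> into \<open>c + p\<close>: splitting \<open>c\<close> off from
  its class in the free object yields an ai-semiring that satisfies all short identities of
  \<^term>\<open>S_4_124\<close> but not \<open>c \<approx> c + p\<close>.
\<close>

subsection \<open>Quotients\<close>

text \<open>A countable quotient fits into any infinite type: \<open>h\<close> numbers a chosen
  representative of each class and embeds the numbers into \<open>'a\<close>. This moves algebras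
  over other types into the universe of the variety.\<close>

lemma quotient_transfer:
  fixes A :: "'b alg"
  assumes inf: "infinite (UNIV :: 'a set)" and A: "ai_semiring A" and cA: "countable (carrier A)"
    and \<theta>: "equivp \<theta>"
    and cong: "\<And>x x' y y'. \<lbrakk>x \<in> carrier A; x' \<in> carrier A; y \<in> carrier A; y' \<in> carrier A;
      \<theta> x x'; \<theta> y y'\<rbrakk> \<Longrightarrow> \<theta> (add A x y) (add A x' y') \<and> \<theta> (mul A x y) (mul A x' y')"
  obtains B :: "'a alg" and h where "is_hom A B h" "h ` carrier A = carrier B"
    "\<And>x y. x \<in> carrier A \<Longrightarrow> y \<in> carrier A \<Longrightarrow> h x = h y \<longleftrightarrow> \<theta> x y"
proof -
  obtain f :: "nat \<Rightarrow> 'a" where f: "inj f"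
    using infinite_countable_subset[OF inf] by blast
  define h where "h x = f (to_nat_on (carrier A) (SOME y. y \<in> carrier A \<and> \<theta> x y))" for x
  have s: "(SOME y. y \<in> carrier A \<and> \<theta> x y) \<in> carrier A \<and> \<theta> x (SOME y. y \<in> carrier A \<and> \<theta> x y)"
    if "x \<in> carrier A" for x
    by (rule someI[of "\<lambda>y. y \<in> carrier A \<and> \<theta> x y" x]) (use that equivp_reflp[OF \<theta>] in auto)
  have h: "h x = h y \<longleftrightarrow> \<theta> x y" if xy: "x \<in> carrier A" "y \<in> carrier A" for x y
  proof
    assume "h x = h y"
    then have "(SOME z. z \<in> carrier A \<and> \<theta> x z) = (SOME z. z \<in> carrier A \<and> \<theta> y z)"
      using f cA s[OF xy(1)] s[OF xy(2)] by (simp add: h_def inj_eq)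
    then show "\<theta> x y" using s[OF xy(1)] s[OF xy(2)] \<theta> by (metis equivp_symp equivp_transp)
  next
    assume "\<theta> x y"
    then have "\<theta> x = \<theta> y" using \<theta> by (simp add: equivp_def)
    then show "h x = h y" by (simp add: h_def)
  qed
  define r where "r = inv_into (carrier A) h"
  have r: "r (h x) \<in> carrier A" "\<theta> x (r (h x))" if "x \<in> carrier A" for x
    using that h inv_into_into[of "h x" h "carrier A"] f_inv_into_f[of "h x" h "carrier A"]
    using \<theta> by (auto simp: r_def intro: equivp_symp)
  define B where "B = \<lparr>carrier = h ` carrier A, add = \<lambda>x y. h (add A (r x) (r y)),
    mul = \<lambda>x y. h (mul A (r x) (r y))\<rparr>"
  have "h (add A x y) = add B (h x) (h y) \<and> h (mul A x y) = mul B (h x) (h y)"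
    if "x \<in> carrier A" "y \<in> carrier A" for x y
    using cong[of x "r (h x)" y "r (h y)"] r that h ai_semiringD(2,3)[OF A]
    by (auto simp: B_def)
  then have "is_hom A B h" by (auto simp: is_hom_def B_def)
  moreover have "h ` carrier A = carrier B" by (simp add: B_def)
  ultimately show ?thesis using h that by blast
qed

text \<open>Assignments into \<open>B\<close> lift along the surjection \<open>h\<close>, which
  commutes with evaluation, so an identity of the quotient only has to be checked on assignments
  into \<open>A\<close>.\<close>

lemma satisfies_quotientI:
  assumes A: "ai_semiring A" and h: "is_hom A B h" "h ` carrier A = carrier B"
    and e: "is_trm u" "is_trm v"
    and eq: "\<And>\<sigma>. range \<sigma> \<subseteq> carrier A \<Longrightarrow> h (eval_trm A \<sigma> u) = h (eval_trm A \<sigma> v)"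
  shows "satisfies B (u, v)"
  unfolding satisfies_def
proof (intro allI impI)
  note B = hom_image_ai_semiring[OF A h]
  fix \<phi> :: "nat \<Rightarrow> 'b" assume \<phi>: "range \<phi> \<subseteq> carrier B"
  define \<sigma> where "\<sigma> = inv_into (carrier A) h \<circ> \<phi>"
  have \<sigma>: "range \<sigma> \<subseteq> carrier A" "h \<circ> \<sigma> = \<phi>"
    using \<phi> h(2) by (auto simp: \<sigma>_def inv_into_into f_inv_into_f fun_eq_iff image_subset_iff)
  have "eval_trm B \<phi> t = h (eval_trm A \<sigma> t)" if "is_trm t" for t
    using hom_eval_trm[OF A B h(1) that, of \<sigma>] \<sigma> by (simp add: image_subset_iff)
  then show "eval_trm B \<phi> (fst (u, v)) = eval_trm B \<phi> (snd (u, v))" using e eq \<sigma>(1) by simp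
qed

lemma eval_quotient_eq:
  assumes A: "ai_semiring A" and h: "is_hom A B h" "h ` carrier A = carrier B"
    and e: "is_trm u" "is_trm v" "satisfies B (u, v)" and \<sigma>: "range \<sigma> \<subseteq> carrier A"
  shows "h (eval_trm A \<sigma> u) = h (eval_trm A \<sigma> v)"
proof -
  note B = hom_image_ai_semiring[OF A h]
  have "range (h \<circ> \<sigma>) \<subseteq> carrier B" using \<sigma> h(2) by auto
  then have "eval_trm B (h \<circ> \<sigma>) u = eval_trm B (h \<circ> \<sigma>) v"
    using e(3) by (simp add: satisfies_def)
  moreover have "eval_trm B (h \<circ> \<sigma>) t = h (eval_trm A \<sigma> t)" if "is_trm t" for t
    using hom_eval_trm[OF A B h(1) that, of \<sigma>] \<sigma> by (simp add: image_subset_iff)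
  ultimately show ?thesis using e by simp
qed

subsection \<open>The free ai-semiring\<close>

text \<open>Assignments into this algebra are substitutions:
  \<open>eval_trm trm_alg \<sigma> t\<close> is \<open>t\<close> with the term
  \<open>\<sigma> x\<close> put in for each letter \<open>x\<close> and multiplied out.\<close>

definition trm_alg :: "'v trm alg" where
  "trm_alg = \<lparr>carrier = {t. is_trm t}, add = (\<union>), mul = trm_mul\<rparr>"

lemma trm_alg_simps [simp]:
  "carrier trm_alg = {t. is_trm t}" "add trm_alg = (\<union>)" "mul trm_alg = trm_mul"
  by (simp_all add: trm_alg_def)

lemma trm_mul_Un:
  "trm_mul t (u \<union> v) = trm_mul t u \<union> trm_mul t v"
  "trm_mul (t \<union> u) v = trm_mul t v \<union> trm_mul u v"
  by (auto simp: trm_mul_def)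

lemma trm_mul_assoc: "trm_mul (trm_mul t u) v = trm_mul t (trm_mul u v)"
  unfolding trm_mul_def by (auto, metis append.assoc, metis append.assoc)

lemma ai_semiring_trm_alg: "ai_semiring (trm_alg :: 'v trm alg)"
proof -
  have "is_trm {[undefined :: 'v]}" by (simp add: is_trm_def)
  then have "{t :: 'v trm. is_trm t} \<noteq> {}" by blast
  then show ?thesis
    unfolding ai_semiring_def
    by (auto simp: is_trm_un is_trm_mul trm_mul_Un trm_mul_assoc)
qed

lemma countable_trm: "countable {t :: 'v :: countable trm. is_trm t}"
  by (rule countable_subset[OF _ countable_Collect_finite]) (auto simp: is_trm_def)

lemma eval_word_Cons:
  "eval_word A \<phi> (x # w) = (if w = [] then \<phi> x else mul A (\<phi> x) (eval_word A \<phi> w))"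
  by (cases w) (auto simp: eval_word_def)

lemma eval_trm_trm_alg:
  assumes \<sigma>: "\<And>x. is_trm (\<sigma> x)" and t: "is_trm t"
  shows "eval_trm trm_alg \<sigma> t = (\<Union>w\<in>t. eval_word trm_alg \<sigma> w)"
  using t
proof (induction rule: trm_induct)
  case (single w)
  then show ?case using \<sigma> by (simp add: eval_trm_single[OF ai_semiring_trm_alg] image_subset_iff)
next
  case (union w t)
  have "is_trm {w}" using union by (simp add: is_trm_def)
  then have "eval_trm trm_alg \<sigma> ({w} \<union> t) = eval_trm trm_alg \<sigma> {w} \<union> eval_trm trm_alg \<sigma> t"
    using eval_trm_union[OF ai_semiring_trm_alg, of "{w}" t \<sigma>] union \<sigma> by auto
  then show ?case using union \<sigma> by (simp add: eval_trm_single[OF ai_semiring_trm_alg] image_subset_iff)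
qed

lemma is_trm_eval:
  assumes "\<And>x. is_trm (\<sigma> x)" "is_trm t"
  shows "is_trm (eval_trm trm_alg \<sigma> t)"
  using eval_trm_closed[OF ai_semiring_trm_alg assms(2), of \<sigma>] assms(1) by auto

text \<open>This allows a substitution by terms to be thinned out to one word per letter: the
  thinned values remain words of the original value.\<close>

lemma concat_in_eval_word:
  assumes "w \<noteq> []" "\<And>x. x \<in> set w \<Longrightarrow> \<rho> x \<in> \<sigma> x"
  shows "concat (map \<rho> w) \<in> eval_word trm_alg \<sigma> w"
  using assms by (induction w) (auto simp: eval_word_Cons trm_mul_def)

lemma eval_word_singletons:
  assumes "w \<noteq> []"
  shows "eval_word trm_alg (\<lambda>x. {\<rho> x}) w = {concat (map \<rho> w)}"
  using assms by (induction w) (auto simp: eval_word_Cons trm_mul_def)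

lemma eval_trm_singletons:
  assumes "\<And>x. \<rho> x \<noteq> []" "is_trm t"
  shows "eval_trm trm_alg (\<lambda>x. {\<rho> x}) t = (\<lambda>w. concat (map \<rho> w)) ` t"
proof -
  have "[] \<notin> t" using assms(2) by (simp add: is_trm_def)
  then have "eval_word trm_alg (\<lambda>x. {\<rho> x}) w = {concat (map \<rho> w)}" if "w \<in> t" for w
    using that by (metis eval_word_singletons)
  moreover have "is_trm {\<rho> x}" for x using assms(1)[of x] by (simp add: is_trm_def)
  ultimately show ?thesis using assms(2) by (auto simp: eval_trm_trm_alg)
qed

lemma eval_trm_letters: "is_trm t \<Longrightarrow> eval_trm trm_alg (\<lambda>x. {[x]}) t = t"
  by (subst eval_trm_singletons) auto

text \<open>The values of letters consist of nonempty words, so a product of two or more of them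
  contains no word of length one.\<close>

lemma letter_in_eval_word:
  assumes "w \<noteq> []" "\<And>x. is_trm (\<sigma> x)" "[p] \<in> eval_word trm_alg \<sigma> w"
  obtains y where "w = [y]" "[p] \<in> \<sigma> y"
proof (cases w)
  case (Cons y w')
  have "w' = []"
  proof (rule ccontr)
    assume w': "w' \<noteq> []"
    then obtain a b where ab: "[p] = a @ b" "a \<in> \<sigma> y" "b \<in> eval_word trm_alg \<sigma> w'"
      using assms(3) Cons by (auto simp: eval_word_Cons trm_mul_def)
    have "is_trm (eval_word trm_alg \<sigma> w')"
      using eval_word_closed[OF ai_semiring_trm_alg w', of \<sigma>] assms(2) by auto
    then have "a \<noteq> []" "b \<noteq> []" using ab assms(2)[of y] by (auto simp: is_trm_def)
    then show False using ab(1) by (cases a) auto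
  qed
  then show ?thesis using assms(3) Cons that by (simp add: eval_word_Cons)
qed (use assms in simp)

text \<open>\<open>eval_trm S \<phi>\<close> is a homomorphism from the free algebra to
  \<open>S\<close>, so evaluating after a substitution amounts to another assignment into
  \<open>S\<close>.\<close>

lemma satisfies_subst:
  fixes \<sigma> :: "nat \<Rightarrow> nat trm"
  assumes S: "ai_semiring S" and uv: "is_trm u" "is_trm v" "satisfies S (u, v)"
    and \<sigma>: "\<And>x. is_trm (\<sigma> x)"
  shows "satisfies S (eval_trm trm_alg \<sigma> u, eval_trm trm_alg \<sigma> v)"
  unfolding satisfies_def
proof (intro allI impI)
  fix \<phi> :: "nat \<Rightarrow> 'a" assume \<phi>: "range \<phi> \<subseteq> carrier S"
  have h: "is_hom trm_alg S (eval_trm S \<phi>)"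
    unfolding is_hom_def using \<phi>
    by (auto intro!: eval_trm_closed[OF S] eval_trm_union[OF S] eval_trm_mul[OF S])
  have "eval_trm S \<phi> (eval_trm trm_alg \<sigma> t) = eval_trm S (eval_trm S \<phi> \<circ> \<sigma>) t" if "is_trm t" for t
    using hom_eval_trm[OF ai_semiring_trm_alg S h that, of \<sigma>] \<sigma> by auto
  moreover have "range (eval_trm S \<phi> \<circ> \<sigma>) \<subseteq> carrier S"
    using \<phi> \<sigma> by (auto intro!: eval_trm_closed[OF S])
  ultimately show "eval_trm S \<phi> (fst (eval_trm trm_alg \<sigma> u, eval_trm trm_alg \<sigma> v))
    = eval_trm S \<phi> (snd (eval_trm trm_alg \<sigma> u, eval_trm trm_alg \<sigma> v))"
    using uv by (simp add: satisfies_def)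
qed

lemma satisfies_sym: "satisfies S (t, u) \<Longrightarrow> satisfies S (u, t)"
  by (simp add: satisfies_def)

lemma satisfies_trans: "satisfies S (t, u) \<Longrightarrow> satisfies S (u, v) \<Longrightarrow> satisfies S (t, v)"
  by (simp add: satisfies_def)

lemma satisfies_Un_mul:
  fixes t :: "nat trm"
  assumes S: "ai_semiring S" and "is_trm t" "is_trm t'" "is_trm u" "is_trm u'"
    and "satisfies S (t, t')" "satisfies S (u, u')"
  shows "satisfies S (t \<union> u, t' \<union> u')" "satisfies S (trm_mul t u, trm_mul t' u')"
proof -
  have "eval_trm S \<phi> (t \<union> u) = eval_trm S \<phi> (t' \<union> u') \<and>
    eval_trm S \<phi> (trm_mul t u) = eval_trm S \<phi> (trm_mul t' u')"
    if \<phi>: "range \<phi> \<subseteq> carrier S" for \<phi>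
  proof -
    have c: "\<phi> ` X \<subseteq> carrier S" for X using \<phi> by auto
    show ?thesis using assms \<phi>
      by (simp add: eval_trm_union[OF S _ _ c] eval_trm_mul[OF S _ _ c] satisfies_def)
  qed
  then show "satisfies S (t \<union> u, t' \<union> u')" "satisfies S (trm_mul t u, trm_mul t' u')"
    by (simp_all add: satisfies_def)
qed

subsection \<open>Identities of the semiring as linear constraints on weights\<close>

definition weight :: "('v \<Rightarrow> nat) \<Rightarrow> 'v list \<Rightarrow> nat" where
  "weight \<tau> w = sum_list (map \<tau> w)"

lemma weight_simps [simp]:
  "weight \<tau> [] = 0" "weight \<tau> (x # w) = \<tau> x + weight \<tau> w"
  by (simp_all add: weight_def)

lemma weight_cong_mset: "mset v = mset w \<Longrightarrow> weight \<tau> v = weight \<tau> w"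
  unfolding weight_def by (metis mset_map sum_mset_sum_list)

lemma weight_ge: "x \<in> set w \<Longrightarrow> \<tau> x \<le> weight \<tau> w"
  by (simp add: weight_def member_le_sum_list)

definition pow4 :: "nat \<Rightarrow> nat" where
  "pow4 n = (if n = 0 then 3 else if n = 1 then 4 else if n = 2 then 2 else 1)"

lemma pow4_add: "pow4 (m + n) = mul S_4_124 (pow4 m) (pow4 n)"
  by (auto simp: pow4_def S_4_124_def)

lemma range_pow4: "range pow4 = carrier S_4_124"
proof
  show "carrier S_4_124 \<subseteq> range pow4"
    by (auto simp: S_4_124_def intro: rev_image_eqI[of 0 _ 3] rev_image_eqI[of 1 _ 4]
      rev_image_eqI[of 2 _ 2] rev_image_eqI[of 3 _ 1] simp: pow4_def)
qed (auto simp: pow4_def S_4_124_def)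

lemma eval_word_pow4:
  assumes "w \<noteq> []"
  shows "eval_word S_4_124 (pow4 \<circ> \<tau>) w = pow4 (weight \<tau> w)"
  using assms
proof (induction w rule: list_nonempty_induct)
  case (cons x xs)
  then show ?case by (simp add: eval_word_Cons pow4_add)
qed (simp add: eval_word_def)

lemma eval_trm_le_iff:
  assumes A: "ai_semiring A" and t: "is_trm t" and \<phi>: "range \<phi> \<subseteq> carrier A" and z: "z \<in> carrier A"
  shows "add A (eval_trm A \<phi> t) z = z \<longleftrightarrow> (\<forall>w\<in>t. add A (eval_word A \<phi> w) z = z)"
proof -
  from t obtain ws where ws: "ws \<noteq> []" "[] \<notin> set ws" "t = set ws" by (rule trm_enum)
  have "eval_word A \<phi> w \<in> carrier A" if "w \<in> set ws" for w
    using that ws \<phi> by (intro eval_word_closed[OF A]) auto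
  moreover have "eval_trm A \<phi> (set ws) = foldr1 (add A) (map (eval_word A \<phi>) ws)"
    using ws \<phi> by (intro eval_trm_set[OF A]) auto
  ultimately show ?thesis
    using foldr1_add_le_iff[OF A, of "map (eval_word A \<phi>) ws" z] ws z by auto
qed

text \<open>In the order where \<open>x\<close> lies below \<open>z\<close> iff
  \<open>add S_4_124 x z = z\<close>, a sum lies below \<open>z\<close> iff all its words do, and an
  element is determined by which of \<open>3\<close>, \<open>4\<close>, \<open>2\<close> lie above
  it (\<open>1\<close> is the top). The exponents of the powers below these three form the sets
  \<open>{0}\<close>, \<open>{1}\<close>, \<open>{0, 2}\<close>.\<close>

lemma satisfies_S_4_124_iff:
  assumes t: "is_trm t" and u: "is_trm u"
  shows "satisfies S_4_124 (t, u) \<longleftrightarrow>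
    (\<forall>\<tau>. \<forall>Q\<in>{{0}, {1}, {0, 2}}. weight \<tau> ` t \<subseteq> Q \<longleftrightarrow> weight \<tau> ` u \<subseteq> Q)"
proof -
  note S = ai_semiring_S_4_124
  have c: "range (pow4 \<circ> \<tau>) \<subseteq> carrier S_4_124" for \<tau> :: "nat \<Rightarrow> nat"
    using range_pow4 by auto
  have le: "add S_4_124 (eval_trm S_4_124 (pow4 \<circ> \<tau>) s) z = z \<longleftrightarrow>
      weight \<tau> ` s \<subseteq> {n. add S_4_124 (pow4 n) z = z}"
    if s: "is_trm s" and z: "z \<in> carrier S_4_124" for \<tau> :: "nat \<Rightarrow> nat" and s z
  proof -
    have "w \<noteq> []" if "w \<in> s" for w using that s by (auto simp: is_trm_def)
    then show ?thesis using eval_trm_le_iff[OF S s c z] by (auto simp: eval_word_pow4)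
  qed
  have Q: "{n. add S_4_124 (pow4 n) 3 = 3} = {0}" "{n. add S_4_124 (pow4 n) 4 = 4} = {1}"
    "{n. add S_4_124 (pow4 n) 2 = 2} = {0, 2}"
    unfolding set_eq_iff mem_Collect_eq by (simp_all add: pow4_def S_4_124_def)
  have z: "3 \<in> carrier S_4_124" "4 \<in> carrier S_4_124" "2 \<in> carrier S_4_124"
    by (auto simp: S_4_124_def)
  have sep: "a = b \<longleftrightarrow> (\<forall>z\<in>{3, 4, 2}. add S_4_124 a z = z \<longleftrightarrow> add S_4_124 b z = z)"
    if "a \<in> carrier S_4_124" "b \<in> carrier S_4_124" for a b
  proof -
    have "a = 1 \<or> a = 2 \<or> a = 3 \<or> a = 4" "b = 1 \<or> b = 2 \<or> b = 3 \<or> b = 4"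
      using that by (auto simp: S_4_124_def)
    then show ?thesis by (elim disjE) (simp_all add: S_4_124_def)
  qed
  have "satisfies S_4_124 (t, u) \<longleftrightarrow>
    (\<forall>\<tau>. eval_trm S_4_124 (pow4 \<circ> \<tau>) t = eval_trm S_4_124 (pow4 \<circ> \<tau>) u)" (is "_ \<longleftrightarrow> ?R")
  proof
    assume ?R
    show "satisfies S_4_124 (t, u)"
      unfolding satisfies_def
    proof (intro allI impI)
      fix \<phi> :: "nat \<Rightarrow> nat" assume "range \<phi> \<subseteq> carrier S_4_124"
      \<comment> \<open>\<open>pow4\<close> is onto the carrier, so every assignment comes from a
        weighting of the letters.\<close>
      then have "\<phi> = pow4 \<circ> (\<lambda>x. inv pow4 (\<phi> x))"
        unfolding fun_eq_iff range_pow4[symmetric] by (simp add: f_inv_into_f image_subset_iff)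
      then show "eval_trm S_4_124 \<phi> (fst (t, u)) = eval_trm S_4_124 \<phi> (snd (t, u))"
        using \<open>?R\<close> by (metis fst_conv snd_conv)
    qed
  qed (use c in \<open>auto simp: satisfies_def\<close>)
  moreover have "eval_trm S_4_124 (pow4 \<circ> \<tau>) t = eval_trm S_4_124 (pow4 \<circ> \<tau>) u \<longleftrightarrow>
    (\<forall>Q\<in>{{0}, {1}, {0, 2}}. weight \<tau> ` t \<subseteq> Q \<longleftrightarrow> weight \<tau> ` u \<subseteq> Q)" for \<tau>
  proof -
    have "eval_trm S_4_124 (pow4 \<circ> \<tau>) s \<in> carrier S_4_124" if "is_trm s" for s
      using c by (intro eval_trm_closed[OF S that]) auto
    from sep[OF this[OF t] this[OF u]] show ?thesis
      unfolding ball_simps le[OF t z(1)] le[OF t z(2)] le[OF t z(3)]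
        le[OF u z(1)] le[OF u z(2)] le[OF u z(3)] Q by simp
  qed
  ultimately show ?thesis by simp
qed

lemma satisfies_S_4_124D:
  assumes "is_trm t" "is_trm u" "satisfies S_4_124 (t, u)" "Q \<in> {{0}, {1}, {0, 2}}"
    and "\<And>w. w \<in> t \<Longrightarrow> weight \<tau> w \<in> Q" "w \<in> u"
  shows "weight \<tau> w \<in> Q"
proof -
  have "weight \<tau> ` t \<subseteq> Q \<longleftrightarrow> weight \<tau> ` u \<subseteq> Q"
    by (rule assms(3)[unfolded satisfies_S_4_124_iff[OF assms(1,2)], rule_format, OF assms(4)])
  then show ?thesis using assms(5,6) by blast
qed

subsection \<open>Odd cycles\<close>

text \<open>The letter \<open>0\<close> is an apex and the letters \<open>1, \<dots>, N\<close> are the vertices of a cycle.\<close>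

definition cycle_word :: "nat \<Rightarrow> nat \<Rightarrow> nat list" where
  "cycle_word N i = [0, Suc i, Suc (Suc i mod N)]"

definition cycle_trm :: "nat \<Rightarrow> nat trm" where
  "cycle_trm N = cycle_word N ` {..<N}"

text \<open>Weights ignore the order of letters, so words are compared as multisets. For odd
  \<open>N\<close> this is smaller than the set of terms that \<open>S_4_124\<close> identifies with
  \<open>cycle_trm N\<close>: it omits \<open>cycle_trm N \<union> {[0]}\<close>.\<close>

definition cycle_class :: "nat \<Rightarrow> nat trm set" where
  "cycle_class N = {t. mset ` t = mset ` cycle_trm N}"

lemma weight_cycle_word:
  "weight \<tau> (cycle_word N i) = \<tau> 0 + \<tau> (Suc i) + \<tau> (Suc (Suc i mod N))"
  by (simp add: cycle_word_def)

lemma cycle_class_wordD: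
  assumes "t \<in> cycle_class N" "w \<in> t"
  obtains i where "i < N" "mset w = mset (cycle_word N i)"
proof -
  have "mset w \<in> mset ` cycle_trm N" using assms by (auto simp: cycle_class_def)
  then show ?thesis using that by (auto simp: cycle_trm_def)
qed

lemma is_trm_cycle_trm: "0 < N \<Longrightarrow> is_trm (cycle_trm N)"
  by (auto simp: is_trm_def cycle_trm_def cycle_word_def)

text \<open>A sum of \<open>1\<close> flips the parity at every step. After the even number
  \<open>N - 1\<close> of steps the last value has the parity of \<open>x 0\<close>, yet these two
  also add up to \<open>1\<close>.\<close>

lemma odd_cycle_not_alternating:
  assumes "odd N" and x: "\<And>i. i < N \<Longrightarrow> x i + x (Suc i mod N) = (1 :: nat)"
  shows False
proof -
  obtain n where N: "N = Suc n" using assms(1) by (cases N) auto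
  have "even (x i) \<longleftrightarrow> (even (x 0) \<longleftrightarrow> even i)" if "i \<le> n" for i
    using that
  proof (induction i)
    case (Suc i)
    then have "x i + x (Suc i) = 1" using x[of i] N by simp
    then have "even (x (Suc i)) \<longleftrightarrow> odd (x i)" by presburger
    then show ?case using Suc by auto
  qed simp
  from this[of n] have "even (x n) \<longleftrightarrow> even (x 0)" using assms(1) N by auto
  moreover have "x n + x 0 = 1" using x[of n] N by simp
  ultimately show False by presburger
qed

lemma satisfies_odd_cycle:
  assumes N: "odd N"
  shows "satisfies S_4_124 (cycle_trm N, cycle_trm N \<union> {[0]})"
proof -
  have "0 < N" using N by (cases N) auto
  then have t: "is_trm (cycle_trm N)" by (rule is_trm_cycle_trm)
  then have u: "is_trm (cycle_trm N \<union> {[0]})" by (simp add: is_trm_def)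
  have "weight \<tau> [0] \<in> Q" if Q: "Q \<in> {{0}, {1}, {0, 2}}" and w: "weight \<tau> ` cycle_trm N \<subseteq> Q" for \<tau> Q
  proof -
    have e: "\<tau> 0 + \<tau> (Suc i) + \<tau> (Suc (Suc i mod N)) \<in> Q" if "i < N" for i
      using w that by (auto simp: cycle_trm_def weight_cycle_word[symmetric])
    have "\<not> (\<forall>i<N. \<tau> (Suc i) + \<tau> (Suc (Suc i mod N)) = 1)"
      using odd_cycle_not_alternating[OF N, of "\<lambda>i. \<tau> (Suc i)"] by blast
    then obtain i where i: "i < N" "\<tau> (Suc i) + \<tau> (Suc (Suc i mod N)) \<noteq> 1" by blast
    \<comment> \<open>The apex weighs at most as much as a word whose weight is in \<open>Q\<close>.
      If it were outside \<open>Q\<close>, it would be \<open>0\<close> for \<open>Q = {1}\<close>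
      or \<open>1\<close> for \<open>Q = {0, 2}\<close>, and either forces total weight
      \<open>1\<close> on the vertices of edge \<open>i\<close>.\<close>
    show ?thesis using e[OF i(1)] i(2) Q by auto
  qed
  then show ?thesis unfolding satisfies_S_4_124_iff[OF t u] by auto
qed

text \<open>Removing an edge leaves a path, whose vertices can be given the weights \<open>0\<close> and \<open>1\<close>
  alternately; with the apex of weight \<open>1\<close>, all remaining words get weight \<open>2\<close>.\<close>

lemma apex_notin_if_edge_missing:
  assumes t: "is_trm t" "is_trm t'" "satisfies S_4_124 (t, t')" and m: "m < N"
    and w: "\<And>w. w \<in> t \<Longrightarrow> \<exists>i<N. i \<noteq> m \<and> mset w = mset (cycle_word N i)"
  shows "[0] \<notin> t'"
proof
  assume 0: "[0] \<in> t'"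
  \<comment> \<open>\<open>d j\<close> counts the steps along the cycle from the far end of the
    missing edge \<open>m\<close> to vertex \<open>j\<close>. It grows by one along every edge
    except \<open>m\<close>, so its parity alternates there.\<close>
  define d where "d j = (if m < j then j - Suc m else j + N - Suc m)" for j
  define \<tau> where "\<tau> x = (case x of 0 \<Rightarrow> 1 | Suc j \<Rightarrow> d j mod 2)" for x
  have "weight \<tau> w \<in> {0, 2}" if "w \<in> t" for w
  proof -
    from w[OF that] obtain i where i: "i < N" "i \<noteq> m" "mset w = mset (cycle_word N i)" by blast
    have "d (Suc i mod N) = Suc (d i)"
      using i(1,2) m by (cases "Suc i = N") (auto simp: d_def)
    then have "\<tau> (Suc i) + \<tau> (Suc (Suc i mod N)) = 1"
      by (simp add: \<tau>_def) presburger
    then show ?thesis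
      by (simp add: weight_cong_mset[OF i(3)] weight_cycle_word \<tau>_def)
  qed
  from satisfies_S_4_124D[OF t _ this 0] show False by (simp add: \<tau>_def)
qed

lemma Suc_mod_neq: "2 \<le> N \<Longrightarrow> i < N \<Longrightarrow> Suc i mod N \<noteq> i"
  by (cases "Suc i = N") auto

text \<open>Every weighting that sends the cycle words into \<open>Q\<close> restricts the words of
  \<open>t'\<close>. Together the weightings below leave only rearranged cycle words and the apex
  alone; the converse direction of the identity shows that no edge is lost.\<close>

lemma cycle_class_isolated:
  assumes N: "3 \<le> N" and t: "is_trm t" "is_trm t'" "satisfies S_4_124 (t, t')"
    and tK: "t \<in> cycle_class N" and 0: "[0] \<notin> t'"
  shows "t' \<in> cycle_class N"
proof -
  have D: "weight \<tau> w \<in> Q" if "Q \<in> {{0}, {1}, {0, 2}}" "w \<in> t'"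
    "\<And>i. i < N \<Longrightarrow> weight \<tau> (cycle_word N i) \<in> Q" for \<tau> w Q
  proof (rule satisfies_S_4_124D[OF t that(1) _ that(2)])
    fix v assume "v \<in> t"
    from tK this obtain i where "i < N" "mset v = mset (cycle_word N i)" by (rule cycle_class_wordD)
    then show "weight \<tau> v \<in> Q" using that(3) weight_cong_mset by metis
  qed
  \<comment> \<open>Weight \<open>2\<close> on two vertices: a different edge meets them at most
    once and gets \<open>0\<close> or \<open>2\<close>, whereas a word containing both, or one of
    them twice, exceeds \<open>2\<close>.\<close>
  have pair: "weight (\<lambda>x. if x = Suc a \<or> x = Suc b then 2 else 0) (cycle_word N i) \<in> {0, 2}"
    if "i < N" "{a, b} \<noteq> {i, Suc i mod N}" for a b i
    using that Suc_mod_neq[of N i] N by (auto simp: weight_cycle_word)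
  have sub: "\<exists>i<N. mset w = mset (cycle_word N i)" if w: "w \<in> t'" for w
  proof -
    \<comment> \<open>Charging the letters beyond \<open>N\<close> shows that \<open>w\<close> has
      no foreign letter.\<close>
    have "weight (\<lambda>x. if x \<le> N then 0 else 1) w \<in> {0}"
      by (rule D) (use w N in \<open>auto simp: weight_cycle_word Suc_le_eq\<close>)
    then have le: "x \<le> N" if "x \<in> set w" for x
      using weight_ge[OF that, of "\<lambda>x. if x \<le> N then 0 else 1"] by (auto split: if_splits)
    \<comment> \<open>Charging only the apex shows that it occurs exactly once.\<close>
    have "weight (\<lambda>x. if x = 0 then 1 else 0) w \<in> {1}"
      by (rule D) (use w in \<open>auto simp: weight_cycle_word\<close>)
    moreover have "weight (\<lambda>x. if x = 0 then 1 else 0) v = count (mset v) 0" for v :: "nat list"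
      by (induction v) auto
    ultimately have c: "count (mset w) 0 = 1" by simp
    define M where "M = mset w - {#0#}"
    have "0 \<in># mset w" using c by (metis count_greater_zero_iff zero_less_one)
    then have M: "mset w = add_mset 0 M" "0 \<notin># M"
      using c unfolding M_def not_in_iff by simp_all
    \<comment> \<open>Charging everything but the apex leaves no or two further letters; none would
      make \<open>w\<close> the excluded word \<open>[0]\<close>.\<close>
    have "weight (\<lambda>x. if x = 0 then 0 else 1) w \<in> {0, 2}"
      by (rule D) (use w in \<open>auto simp: weight_cycle_word\<close>)
    moreover have "weight (\<lambda>x. if x = 0 then 0 else 1) v + count (mset v) 0 = size (mset v)"
      for v :: "nat list" by (induction v) auto
    from this[of w] have "weight (\<lambda>x. if x = 0 then 0 else 1) w = size M" using c M by simp
    ultimately have "size M \<in> {0, 2}" by simp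
    moreover have "size M \<noteq> 0" using M 0 w by auto
    ultimately have "size M = Suc (Suc 0)" by simp
    then obtain a M' where aM: "M = add_mset a M'" using size_eq_Suc_imp_eq_union by blast
    with \<open>size M = _\<close> obtain b where "M' = {#b#}" using size_1_singleton_mset by auto
    with aM have ab: "M = {#a, b#}" by simp
    have "set w = {0, a, b}" using M(1) ab by (metis set_mset_add_mset_insert set_mset_empty set_mset_mset)
    then have "a \<le> N" "b \<le> N" using le by simp_all
    moreover have "a \<noteq> 0" "b \<noteq> 0" using M(2) ab by auto
    ultimately obtain i j where ij: "a = Suc i" "b = Suc j" "i < N" "j < N"
      by (cases a; cases b) auto
    have wij: "mset w = mset [0, Suc i, Suc j]" unfolding M(1) ab ij by simp
    have "\<exists>k<N. {i, j} = {k, Suc k mod N}"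
    proof (rule ccontr)
      assume "\<not> ?thesis"
      then have "weight (\<lambda>x. if x = Suc i \<or> x = Suc j then 2 else 0) w \<in> {0, 2}"
        using w by (intro D[of "{0, 2}" w] pair) auto
      then show False by (simp add: weight_cong_mset[OF wij])
    qed
    then obtain k where k: "k < N" "{i, j} = {k, Suc k mod N}" by blast
    then have "mset w = mset (cycle_word N k)"
      by (auto simp: wij cycle_word_def doubleton_eq_iff add_mset_commute)
    then show ?thesis using k(1) by blast
  qed
  have sup: "\<exists>w\<in>t'. mset w = mset (cycle_word N k)" if k: "k < N" for k
  proof (rule ccontr)
    assume n: "\<not> ?thesis"
    define \<tau> :: "nat \<Rightarrow> nat"
      where "\<tau> x = (if x = Suc k \<or> x = Suc (Suc k mod N) then 2 else 0)" for x
    have t': "weight \<tau> w \<in> {0, 2}" if w: "w \<in> t'" for w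
    proof -
      obtain i where i: "i < N" "mset w = mset (cycle_word N i)" using sub[OF w] by blast
      then have "{k, Suc k mod N} \<noteq> {i, Suc i mod N}"
        using n w by (auto simp: cycle_word_def doubleton_eq_iff add_mset_commute)
      then show ?thesis
        using pair[OF i(1)] unfolding weight_cong_mset[OF i(2)] \<tau>_def by blast
    qed
    have "mset (cycle_word N k) \<in> mset ` t"
      using tK k by (auto simp: cycle_class_def cycle_trm_def)
    then obtain v where v: "v \<in> t" "mset v = mset (cycle_word N k)" by auto
    \<comment> \<open>The roles are exchanged: without edge \<open>k\<close> all words of
      \<open>t'\<close> have weight \<open>0\<close> or \<open>2\<close>, but \<open>t\<close> has a
      word of weight \<open>4\<close>.\<close>
    have "satisfies S_4_124 (t', t)" using t(3) by (rule satisfies_sym)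
    from satisfies_S_4_124D[OF t(2,1) this _ t' v(1)] have "weight \<tau> v \<in> {0, 2}" by simp
    then show False by (simp add: weight_cong_mset[OF v(2)] weight_cycle_word \<tau>_def)
  qed
  have "mset ` t' \<subseteq> mset ` cycle_trm N"
    using sub by (force simp: cycle_trm_def)
  moreover have "mset ` cycle_trm N \<subseteq> mset ` t'"
  proof
    fix W assume "W \<in> mset ` cycle_trm N"
    then obtain k where "k < N" "W = mset (cycle_word N k)" by (auto simp: cycle_trm_def)
    then show "W \<in> mset ` t'" using sup by (metis imageI)
  qed
  ultimately have "mset ` t' = mset ` cycle_trm N" by simp
  then show ?thesis by (simp add: cycle_class_def)
qed

subsection \<open>Separating an odd cycle from its apex\<close>

text \<open>The congruence of all identities of \<open>S_4_124\<close>, refined only by splitting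
  off \<open>cycle_class N\<close> from the rest of its class.\<close>

definition cycle_equiv :: "nat \<Rightarrow> nat trm \<Rightarrow> nat trm \<Rightarrow> bool" where
  "cycle_equiv N t u \<longleftrightarrow> satisfies S_4_124 (t, u) \<and> (t \<in> cycle_class N \<longleftrightarrow> u \<in> cycle_class N)"

lemma equivp_cycle_equiv: "equivp (cycle_equiv N)"
proof (rule equivpI)
  show "reflp (cycle_equiv N)"
    by (rule reflpI) (simp add: cycle_equiv_def satisfies_def)
  show "symp (cycle_equiv N)"
  proof (rule sympI)
    fix t u assume "cycle_equiv N t u"
    then show "cycle_equiv N u t"
      unfolding cycle_equiv_def by (metis satisfies_sym)
  qed
  show "transp (cycle_equiv N)"
  proof (rule transpI)
    fix t u v assume "cycle_equiv N t u" "cycle_equiv N u v"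
    then show "cycle_equiv N t v"
      unfolding cycle_equiv_def by (metis satisfies_trans)
  qed
qed

lemma apex_notin_cycle_class: "t \<in> cycle_class N \<Longrightarrow> [0] \<notin> t"
proof
  assume "t \<in> cycle_class N" "[0] \<in> t"
  then obtain i where "i < N" "mset [0] = mset (cycle_word N i)" by (rule cycle_class_wordD)
  then show False by (simp add: cycle_word_def)
qed

text \<open>A summand of a cycle term is either itself in \<open>cycle_class N\<close>, and then so
  are its equivalents, or it misses an edge, and then the alternating weights apply.\<close>

lemma apex_notin_equiv_summand:
  assumes t: "is_trm t" "is_trm t'" "cycle_equiv N t t'" and s: "t \<union> s \<in> cycle_class N"
  shows "[0] \<notin> t'"
proof (cases "t \<in> cycle_class N")
  case True
  then have "t' \<in> cycle_class N" using t(3) by (simp add: cycle_equiv_def)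
  then show ?thesis by (rule apex_notin_cycle_class)
next
  case False
  have w: "\<exists>i<N. mset w = mset (cycle_word N i)" if "w \<in> t" for w
    using that s by (metis UnI1 cycle_class_wordD)
  have "\<exists>m<N. mset (cycle_word N m) \<notin> mset ` t"
  proof (rule ccontr)
    assume "\<not> ?thesis"
    then have "mset ` cycle_trm N \<subseteq> mset ` t" by (auto simp: cycle_trm_def)
    moreover have "mset ` t \<subseteq> mset ` cycle_trm N"
    proof (rule image_subsetI)
      fix v assume "v \<in> t"
      from w[OF this] show "mset v \<in> mset ` cycle_trm N" by (auto simp: cycle_trm_def)
    qed
    ultimately show False using False by (simp add: cycle_class_def)
  qed
  then obtain m where m: "m < N" "mset (cycle_word N m) \<notin> mset ` t" by blast
  show ?thesis
  proof (rule apex_notin_if_edge_missing[OF t(1,2) _ m(1)])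
    show "satisfies S_4_124 (t, t')" using t(3) by (simp add: cycle_equiv_def)
    show "\<exists>i<N. i \<noteq> m \<and> mset w = mset (cycle_word N i)" if "w \<in> t" for w
      using w[OF that] m(2) that by (metis image_eqI)
  qed
qed

lemma apex_notin_mul:
  assumes "is_trm t" "is_trm u"
  shows "[0] \<notin> trm_mul t u"
  using assms by (auto simp: trm_mul_def is_trm_def Cons_eq_append_conv)

text \<open>By \<open>cycle_class_isolated\<close> only the apex can lead out of the class. A sum
  contains it only if a summand does, and the words of a product have at least two letters.\<close>

lemma cycle_class_equiv_closed:
  assumes N: "3 \<le> N" and t: "is_trm t" "is_trm t'" "cycle_equiv N t t'"
    and u: "is_trm u" "is_trm u'" "cycle_equiv N u u'"
  shows "t \<union> u \<in> cycle_class N \<Longrightarrow> t' \<union> u' \<in> cycle_class N"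
    and "trm_mul t u \<in> cycle_class N \<Longrightarrow> trm_mul t' u' \<in> cycle_class N"
proof -
  have s: "satisfies S_4_124 (t, t')" "satisfies S_4_124 (u, u')"
    using t u by (simp_all add: cycle_equiv_def)
  note sat = satisfies_Un_mul[OF ai_semiring_S_4_124 t(1,2) u(1,2) s]
  show "t' \<union> u' \<in> cycle_class N" if K: "t \<union> u \<in> cycle_class N"
  proof (rule cycle_class_isolated[OF N _ _ sat(1) K])
    show "[0] \<notin> t' \<union> u'"
      using apex_notin_equiv_summand[OF t K] apex_notin_equiv_summand[OF u, of t] K
      by (simp add: Un_commute)
  qed (use t u is_trm_un in auto)
  show "trm_mul t' u' \<in> cycle_class N" if K: "trm_mul t u \<in> cycle_class N"
    by (rule cycle_class_isolated[OF N _ _ sat(2) K]) (use t u is_trm_mul apex_notin_mul in auto)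
qed

lemma cycle_equiv_cong:
  assumes N: "3 \<le> N" and t: "is_trm t" "is_trm t'" "cycle_equiv N t t'"
    and u: "is_trm u" "is_trm u'" "cycle_equiv N u u'"
  shows "cycle_equiv N (t \<union> u) (t' \<union> u')" "cycle_equiv N (trm_mul t u) (trm_mul t' u')"
proof -
  have s: "satisfies S_4_124 (t, t')" "satisfies S_4_124 (u, u')"
    using t u by (simp_all add: cycle_equiv_def)
  have sym: "cycle_equiv N t' t" "cycle_equiv N u' u"
    using t(3) u(3) equivp_symp[OF equivp_cycle_equiv] by auto
  note closed = cycle_class_equiv_closed[OF N t u]
    cycle_class_equiv_closed[OF N t(2,1) sym(1) u(2,1) sym(2)]
  show "cycle_equiv N (t \<union> u) (t' \<union> u')" "cycle_equiv N (trm_mul t u) (trm_mul t' u')"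
    unfolding cycle_equiv_def
    using satisfies_Un_mul[OF ai_semiring_S_4_124 t(1,2) u(1,2) s] closed by blast+
qed

text \<open>If the apex \<open>0\<close> is a word of the right-hand side, then it is the value of a letter; picking
  one word from the value of every letter turns the left-hand side into fewer than \<open>N\<close> words.\<close>

lemma small_identity_preserves_cycle_class:
  assumes N: "3 \<le> N" and uv: "is_trm u" "is_trm v" "satisfies S_4_124 (u, v)" and card: "card u < N"
    and \<sigma>: "\<And>x. is_trm (\<sigma> x)" and K: "eval_trm trm_alg \<sigma> u \<in> cycle_class N"
  shows "eval_trm trm_alg \<sigma> v \<in> cycle_class N"
proof (rule cycle_class_isolated[OF N is_trm_eval[OF \<sigma> uv(1)] is_trm_eval[OF \<sigma> uv(2)] _ K])
  show "satisfies S_4_124 (eval_trm trm_alg \<sigma> u, eval_trm trm_alg \<sigma> v)"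
    by (rule satisfies_subst[OF ai_semiring_S_4_124 uv \<sigma>])
  show "[0] \<notin> eval_trm trm_alg \<sigma> v"
  proof
    assume "[0] \<in> eval_trm trm_alg \<sigma> v"
    then obtain w where w: "w \<in> v" "[0] \<in> eval_word trm_alg \<sigma> w"
      using \<sigma> uv(2) by (auto simp: eval_trm_trm_alg)
    then have "w \<noteq> []" using uv(2) by (auto simp: is_trm_def)
    then obtain y where y: "[y] \<in> v" "[0] \<in> \<sigma> y"
      using w \<sigma> by (metis letter_in_eval_word)
    \<comment> \<open>\<open>y\<close> is sent to \<open>[0]\<close> so that the apex stays in the
      value of \<open>v\<close>; the choices for the other letters are arbitrary.\<close>
    define \<rho> where "\<rho> x = (if x = y then [0] else SOME a. a \<in> \<sigma> x)" for x
    have \<rho>: "\<rho> x \<in> \<sigma> x" for x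
      using y(2) \<sigma>[of x] by (auto simp: \<rho>_def is_trm_def some_in_eq)
    have ne: "\<rho> x \<noteq> []" for x using \<rho>[of x] \<sigma>[of x] by (auto simp: is_trm_def)
    have s: "is_trm {\<rho> x}" for x using ne[of x] by (simp add: is_trm_def)
    let ?e = "eval_trm trm_alg (\<lambda>x. {\<rho> x})"
    have "concat (map \<rho> w) \<in> eval_trm trm_alg \<sigma> u" if "w \<in> u" for w
      using that concat_in_eval_word[of w \<rho> \<sigma>] \<rho> \<sigma> uv(1)
      by (auto simp: eval_trm_trm_alg is_trm_def)
    then have "\<forall>w\<in>u. \<exists>i<N. mset (concat (map \<rho> w)) = mset (cycle_word N i)"
      using K by (metis cycle_class_wordD)
    then obtain f where f: "\<And>w. w \<in> u \<Longrightarrow> f w < N \<and> mset (concat (map \<rho> w)) = mset (cycle_word N (f w))"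
      by metis
    have "finite u" using uv(1) by (simp add: is_trm_def)
    \<comment> \<open>Each of the fewer than \<open>N\<close> words of \<open>u\<close> lands on one
      edge of the cycle, so some edge \<open>m\<close> is left out.\<close>
    then have "card (f ` u) < card {..<N}" using card card_image_le[of u f] by simp
    then have "\<not> {..<N} \<subseteq> f ` u" using \<open>finite u\<close> card_mono[of "f ` u" "{..<N}"] by auto
    then obtain m where m: "m < N" "m \<notin> f ` u" by auto
    have "[0] \<notin> ?e v"
    proof (rule apex_notin_if_edge_missing[OF is_trm_eval[OF s uv(1)] is_trm_eval[OF s uv(2)] _ m(1)])
      show "satisfies S_4_124 (?e u, ?e v)"
        by (rule satisfies_subst[OF ai_semiring_S_4_124 uv s])
      show "\<exists>i<N. i \<noteq> m \<and> mset w = mset (cycle_word N i)" if "w \<in> ?e u" for w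
        using that f m(2) ne uv(1) by (auto simp: eval_trm_singletons)
    qed
    moreover have "[0] \<in> ?e v"
      using y(1) ne uv(2) by (auto simp: eval_trm_singletons \<rho>_def intro!: image_eqI[of _ _ "[y]"])
    ultimately show False by simp
  qed
qed

lemma cycle_equiv_eval:
  assumes N: "3 \<le> N" and uv: "is_trm u" "is_trm v" "satisfies S_4_124 (u, v)"
    and card: "card u < N" "card v < N" and \<sigma>: "\<And>x. is_trm (\<sigma> x)"
  shows "cycle_equiv N (eval_trm trm_alg \<sigma> u) (eval_trm trm_alg \<sigma> v)"
proof -
  have "satisfies S_4_124 (v, u)" using uv(3) by (rule satisfies_sym)
  then show ?thesis
    unfolding cycle_equiv_def
    using satisfies_subst[OF ai_semiring_S_4_124 uv, of \<sigma>] \<sigma>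
      small_identity_preserves_cycle_class[OF N uv card(1), of \<sigma>]
      small_identity_preserves_cycle_class[OF N uv(2,1) _ card(2), of \<sigma>]
    by blast
qed

section \<open>Refuting a finite basis\<close>

lemma finite_identities_card_bounded:
  assumes "finite \<Sigma>"
  obtains n where "\<And>u v. (u, v) \<in> \<Sigma> \<Longrightarrow> card u < n \<and> card v < n"
proof
  show "card u < Suc (\<Sum>e\<in>\<Sigma>. card (fst e) + card (snd e)) \<and>
      card v < Suc (\<Sum>e\<in>\<Sigma>. card (fst e) + card (snd e))" if "(u, v) \<in> \<Sigma>" for u v
    using member_le_sum[OF that, of "\<lambda>e. card (fst e) + card (snd e)"] assms by simp
qed

theorem corollary3p6:
  assumes "infinite (UNIV :: 'a set)"
  shows "\<not> finitely_based (generated_variety S_4_124 :: 'a alg set)"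
proof
  note S = ai_semiring_S_4_124
  assume "finitely_based (generated_variety S_4_124 :: 'a alg set)"
  then obtain \<Sigma> where \<Sigma>: "finite \<Sigma>" "\<Sigma> \<subseteq> identities"
    and V: "(generated_variety S_4_124 :: 'a alg set) = models \<Sigma>"
    unfolding finitely_based_def by blast
  \<comment> \<open>\<open>S_4_124\<close> has its elements in \<open>nat\<close>, whereas the class
    lives over \<open>'a\<close>. A copy \<open>B\<close> belongs to the class, and the inverse
    isomorphism \<open>g\<close> carries its identities back.\<close>
  have "S_4_124 \<in> models \<Sigma>"
  proof -
    have cS: "countable (carrier S_4_124)" by (simp add: S_4_124_def)
    obtain B :: "'a alg" and h where h: "is_hom S_4_124 B h" "h ` carrier S_4_124 = carrier B"
      and inj: "\<And>x y. x \<in> carrier S_4_124 \<Longrightarrow> y \<in> carrier S_4_124 \<Longrightarrow> h x = h y \<longleftrightarrow> x = y"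
    proof (rule quotient_transfer[OF assms S cS identity_equivp])
      show "add S_4_124 x y = add S_4_124 x' y' \<and> mul S_4_124 x y = mul S_4_124 x' y'"
        if "x = x'" "y = y'" for x x' y y'
        using that by simp
    qed (rule that)
    have "B \<in> generated_variety S_4_124"
      using hom_image_in_models[OF _ generator_in_generated_variety[OF S, unfolded generated_variety_def] h]
      by (simp add: generated_variety_def)
    then have B: "B \<in> models \<Sigma>" by (simp only: V)
    define g where "g = inv_into (carrier S_4_124) h"
    have "inj_on h (carrier S_4_124)" using inj by (auto simp: inj_on_def)
    then have g: "g (h x) = x" if "x \<in> carrier S_4_124" for x
      using that by (simp add: g_def)
    have "is_hom B S_4_124 g"
      unfolding is_hom_def
    proof (intro conjI ballI)
      show "g ` carrier B \<subseteq> carrier S_4_124" using g h(2) by force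
      fix x y assume "x \<in> carrier B" "y \<in> carrier B"
      then obtain a b where "a \<in> carrier S_4_124" "x = h a" "b \<in> carrier S_4_124" "y = h b"
        using h(2) by blast
      then show "g (add B x y) = add S_4_124 (g x) (g y)" "g (mul B x y) = mul S_4_124 (g x) (g y)"
        using h(1) g ai_semiringD(2,3)[OF S] unfolding is_hom_def by metis+
    qed
    moreover have "g ` carrier B = carrier S_4_124"
      unfolding h(2)[symmetric] image_image using g by simp
    ultimately show ?thesis using hom_image_in_models[OF \<Sigma>(2) B] by blast
  qed
  then have sat: "satisfies S_4_124 (u, v)" if "(u, v) \<in> \<Sigma>" for u v
    using that by (auto simp: models_def)
  obtain n where n: "\<And>u v. (u, v) \<in> \<Sigma> \<Longrightarrow> card u < n \<and> card v < n"
    using finite_identities_card_bounded[OF \<Sigma>(1)] by blast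
  \<comment> \<open>Odd, at least \<open>3\<close>, and larger than the number of words on either
    side of any identity in \<open>\<Sigma>\<close>.\<close>
  define N where "N = 2 * n + 3"
  have N: "3 \<le> N" "n \<le> N" "odd N" by (auto simp: N_def)
  \<comment> \<open>This copy of the free algebra modulo \<open>cycle_equiv N\<close> is the
    separating example: it satisfies \<open>\<Sigma>\<close> but violates the odd cycle
    identity.\<close>
  obtain B :: "'a alg" and h where h: "is_hom trm_alg B h" "h ` carrier trm_alg = carrier B"
    and eq: "\<And>t u. is_trm t \<Longrightarrow> is_trm u \<Longrightarrow> h t = h u \<longleftrightarrow> cycle_equiv N t u"
  proof (rule quotient_transfer[OF assms ai_semiring_trm_alg _ equivp_cycle_equiv[of N]])
    show "countable (carrier (trm_alg :: nat trm alg))" using countable_trm by simp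
    show "cycle_equiv N (add trm_alg t u) (add trm_alg t' u') \<and>
        cycle_equiv N (mul trm_alg t u) (mul trm_alg t' u')"
      if "t \<in> carrier trm_alg" "t' \<in> carrier trm_alg" "u \<in> carrier trm_alg" "u' \<in> carrier trm_alg"
        "cycle_equiv N t t'" "cycle_equiv N u u'" for t t' u u'
      using that cycle_equiv_cong[OF N(1), of t t' u u'] by simp
  qed (rule that; simp)
  have "satisfies B (u, v)" if e: "(u, v) \<in> \<Sigma>" for u v
  proof -
    have uv: "is_trm u" "is_trm v" using e \<Sigma>(2) by (auto simp: identities_def)
    show ?thesis
    proof (rule satisfies_quotientI[OF ai_semiring_trm_alg h uv])
      fix \<sigma> :: "nat \<Rightarrow> nat trm" assume "range \<sigma> \<subseteq> carrier trm_alg"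
      then have \<sigma>: "is_trm (\<sigma> x)" for x by auto
      show "h (eval_trm trm_alg \<sigma> u) = h (eval_trm trm_alg \<sigma> v)"
        using eq is_trm_eval[of \<sigma>] \<sigma> uv cycle_equiv_eval[OF N(1) uv sat[OF e]] n[OF e] N(2)
        by auto
    qed
  qed
  then have "B \<in> models \<Sigma>"
    using hom_image_ai_semiring[OF ai_semiring_trm_alg h] by (auto simp: models_def)
  then have B: "B \<in> models {e \<in> identities. satisfies S_4_124 e}"
    using V by (simp add: generated_variety_def)
  have c: "is_trm (cycle_trm N)" using N by (intro is_trm_cycle_trm) simp
  then have c': "is_trm (cycle_trm N \<union> {[0]})" by (simp add: is_trm_def)
  have "satisfies B (cycle_trm N, cycle_trm N \<union> {[0]})"
    using B c c' satisfies_odd_cycle[OF N(3)] unfolding models_def identities_def by blast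
  \<comment> \<open>Under the identity substitution the two sides are their own values, so the
    identity in \<open>B\<close> would make them equivalent.\<close>
  from eval_quotient_eq[OF ai_semiring_trm_alg h c c' this, of "\<lambda>x. {[x]}"]
  have "h (cycle_trm N) = h (cycle_trm N \<union> {[0]})"
    unfolding eval_trm_letters[OF c] eval_trm_letters[OF c'] by (auto simp: is_trm_def)
  then have "cycle_trm N \<union> {[0]} \<in> cycle_class N"
    using eq c c' by (auto simp: cycle_equiv_def cycle_class_def)
  then show False using apex_notin_cycle_class by blast
qed

end
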